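(* Let $n\ge 1$ and let $t\ge 0$ be an even integer. Let $G$ be the graph obtained from the complete graph $K_n$ by subdividing every edge exactly $t$ times (i.e., replacing each edge by a path with $t$ new internal vertices). Then $G$ admits a drawing $\varphi$ in $\mathbb{R}^2$ such that for every pair of shortest paths $P_1,P_2$ in $G$, the curves $\varphi(P_1)$ and $\varphi(P_2)$ cross at most four times.
   Context: A drawing $\varphi$ of a graph $G$ in $\mathbb{R}^2$ maps the vertices to pairwise distinct points and each edge to a Jordan arc between the images of its two end-vertices that is disjoint from the image of every other vertex. For a path $P=v_1,\dots,v_n$ in $G$, $\varphi(P)$ denotes the arc obtained by concatenating the curves $\varphi(v_1v_2),\dots,\varphi(v_{n-1}v_n)$. For two curves $\gamma_1,\gamma_2:[0,1]\to\mathbb{R}^2$, a meet is a pair of maximal intervals $I_1,I_2\subseteq[0,1]$ together with a bijection $\iota:I_1\to I_2$ such that $\gamma_1(x)=\gamma_2(\iota(x))$ for all $x\in I_1$. A crossing is a meet with $(I_1\cup I_2)\cap\{0,1\}=\emptyset$. Two curves cross $k$ times if they have $k$ pairwise distinct crossings. *)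

theory Defs
  imports
    "HOL-Analysis.Analysis"
    "Graph_Theory.Graph_Theory"
begin

text \<open>Undirected graphs are symmetric loop-free digraphs, as in Graph_Theory.\<close>

text \<open>
  \<open>Inner u v k\<close> with \<open>u < v\<close> is the \<open>k\<close>-th new vertex on the edge \<open>uv\<close>, counted from \<open>u\<close>.
  The linear order only serves to name each new vertex once.
\<close>

datatype 'a sd_vertex = Branch 'a | Inner 'a 'a nat

definition sd_point :: "nat \<Rightarrow> 'a \<Rightarrow> 'a \<Rightarrow> nat \<Rightarrow> 'a sd_vertex" where
  "sd_point t u v k =
     (if k = 0 then Branch u else if k = t + 1 then Branch v else Inner u v k)"

definition subdivide_all ::
    "nat \<Rightarrow> 'a::linorder pair_pre_digraph \<Rightarrow> 'a sd_vertex pair_pre_digraph" where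
  "subdivide_all t G =
     \<lparr> pverts = Branch ` pverts G \<union>
         {Inner u v k | u v k. (u, v) \<in> parcs G \<and> u < v \<and> 1 \<le> k \<and> k \<le> t},
       parcs = (let A = {(sd_point t u v k, sd_point t u v (k + 1)) | u v k.
                           (u, v) \<in> parcs G \<and> u < v \<and> k \<le> t}
                in A \<union> A\<inverse>) \<rparr>"

lemma subdivide_all_0:
  assumes "pair_graph G"
  shows "pverts (subdivide_all 0 G) = Branch ` pverts G"
    and "parcs (subdivide_all 0 G) = map_prod Branch Branch ` parcs G"
proof -
  interpret pair_graph G by fact
  show "pverts (subdivide_all 0 G) = Branch ` pverts G"
    by (auto simp: subdivide_all_def)
  have s: "(v, u) \<in> parcs G" if "(u, v) \<in> parcs G" for u v
    using that by (rule arcs_symmetric)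
  have n: "u \<noteq> v" if "(u, v) \<in> parcs G" for u v
    using pair_no_loops[OF that] by simp
  show "parcs (subdivide_all 0 G) = map_prod Branch Branch ` parcs G" (is "?L = ?R")
  proof
    show "?L \<subseteq> ?R"
      by (force simp: subdivide_all_def Let_def sd_point_def intro: s)
    show "?R \<subseteq> ?L"
    proof
      fix e assume "e \<in> ?R"
      then obtain u v where e: "e = (Branch u, Branch v)" and uv: "(u, v) \<in> parcs G" by auto
      show "e \<in> ?L"
        using n[OF uv] s[OF uv] uv unfolding e subdivide_all_def Let_def sd_point_def
        by (cases u v rule: linorder_cases) auto
    qed
  qed
qed

lemma pair_graph_subdivide_all:
  assumes "pair_graph G"
  shows "pair_graph (subdivide_all t G)"
proof -
  interpret pair_graph G by fact
  define A where "A = {(sd_point t u v k, sd_point t u v (k + 1)) | u v k.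
                         (u, v) \<in> parcs G \<and> u < v \<and> k \<le> t}"
  have arcs: "parcs (subdivide_all t G) = A \<union> A\<inverse>"
    by (simp add: subdivide_all_def A_def Let_def)
  have "A \<subseteq> (\<lambda>((u, v), k). (sd_point t u v k, sd_point t u v (k + 1))) ` (parcs G \<times> {..t})"
    by (force simp: A_def)
  then have finA: "finite A" by (rule finite_subset) auto
  have "{Inner u v k | u v k. (u, v) \<in> parcs G \<and> u < v \<and> 1 \<le> k \<and> k \<le> t}
          \<subseteq> (\<lambda>((u, v), k). Inner u v k) ` (parcs G \<times> {..t})"
    by force
  then have "finite {Inner u v k | u v k. (u, v) \<in> parcs G \<and> u < v \<and> 1 \<le> k \<and> k \<le> t}"
    by (rule finite_subset) auto
  then have finV: "finite (pverts (subdivide_all t G))"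
    by (simp add: subdivide_all_def)
  have pt: "sd_point t u v k \<in> pverts (subdivide_all t G)"
    if "(u, v) \<in> parcs G" "u < v" "k \<le> t + 1" for u v k
    using that in_arcsD1[OF that(1)] in_arcsD2[OF that(1)]
    by (auto simp: subdivide_all_def sd_point_def)
  have wf: "x \<in> pverts (subdivide_all t G) \<and> y \<in> pverts (subdivide_all t G) \<and> x \<noteq> y"
    if "(x, y) \<in> A" for x y
    using that by (auto simp: A_def intro!: pt) (auto simp: sd_point_def split: if_splits)
  show ?thesis
  proof
    fix e assume "e \<in> parcs (subdivide_all t G)"
    then show "fst e \<in> pverts (subdivide_all t G)" "snd e \<in> pverts (subdivide_all t G)"
      "fst e \<noteq> snd e"
      by (cases e; auto simp: arcs dest: wf)+
  next
    show "finite (pverts (subdivide_all t G))" by (rule finV)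
    show "finite (parcs (subdivide_all t G))" using finA by (simp add: arcs)
    show "symmetric (with_proj (subdivide_all t G))"
      by (auto simp: symmetric_def arcs sym_def)
  qed
qed

definition shortest_path :: "'a pair_pre_digraph \<Rightarrow> 'a vwalk \<Rightarrow> bool" where
  "shortest_path G p \<longleftrightarrow> vpath p G \<and>
     (\<forall>q. vpath q G \<and> hd q = hd p \<and> last q = last p \<longrightarrow> vwalk_length p \<le> vwalk_length q)"

text \<open>
  A drawing consists of a point for every vertex and a Jordan arc for every edge
  \<open>{u, v}\<close>, parametrised in either of its two directions.
\<close>

definition is_drawing ::
    "'a pair_pre_digraph \<Rightarrow> ('a \<Rightarrow> real \<times> real) \<Rightarrow> ('a set \<Rightarrow> real \<Rightarrow> real \<times> real) \<Rightarrow> bool" where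
  "is_drawing G pos crv \<longleftrightarrow>
     inj_on pos (pverts G) \<and>
     (\<forall>(u, v) \<in> parcs G.
        arc (crv {u, v}) \<and>
        {pathstart (crv {u, v}), pathfinish (crv {u, v})} = {pos u, pos v} \<and>
        (\<forall>w \<in> pverts G - {u, v}. pos w \<notin> path_image (crv {u, v})))"

definition edge_curve ::
    "('a \<Rightarrow> real \<times> real) \<Rightarrow> ('a set \<Rightarrow> real \<Rightarrow> real \<times> real) \<Rightarrow> 'a \<Rightarrow> 'a \<Rightarrow> real \<Rightarrow> real \<times> real" where
  "edge_curve pos crv u v =
     (if pathstart (crv {u, v}) = pos u then crv {u, v} else reversepath (crv {u, v}))"

text \<open>
  Only paths with at least one edge have a curve. The speed at which the joined curve is
  traversed is irrelevant, since meets are invariant under reparametrisation.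
\<close>

fun path_curve ::
    "('a \<Rightarrow> real \<times> real) \<Rightarrow> ('a set \<Rightarrow> real \<Rightarrow> real \<times> real) \<Rightarrow> 'a vwalk \<Rightarrow> real \<Rightarrow> real \<times> real" where
  "path_curve pos crv [u, v] = edge_curve pos crv u v"
| "path_curve pos crv (u # v # w # p) = edge_curve pos crv u v +++ path_curve pos crv (v # w # p)"

definition common_part ::
    "(real \<Rightarrow> 'b) \<Rightarrow> (real \<Rightarrow> 'b) \<Rightarrow> real set \<Rightarrow> real set \<Rightarrow> (real \<Rightarrow> real) \<Rightarrow> bool" where
  "common_part \<gamma>\<^sub>1 \<gamma>\<^sub>2 I\<^sub>1 I\<^sub>2 \<iota> \<longleftrightarrow>
     is_interval I\<^sub>1 \<and> I\<^sub>1 \<noteq> {} \<and> I\<^sub>1 \<subseteq> {0..1} \<and>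
     is_interval I\<^sub>2 \<and> I\<^sub>2 \<noteq> {} \<and> I\<^sub>2 \<subseteq> {0..1} \<and>
     bij_betw \<iota> I\<^sub>1 I\<^sub>2 \<and> (\<forall>x\<in>I\<^sub>1. \<gamma>\<^sub>1 x = \<gamma>\<^sub>2 (\<iota> x))"

text \<open>
  The bijection is kept \<open>undefined\<close> outside \<open>I\<^sub>1\<close>, so that equal meets are equal triples.
\<close>

definition meets ::
    "(real \<Rightarrow> 'b) \<Rightarrow> (real \<Rightarrow> 'b) \<Rightarrow> (real set \<times> real set \<times> (real \<Rightarrow> real)) set" where
  "meets \<gamma>\<^sub>1 \<gamma>\<^sub>2 = {(I\<^sub>1, I\<^sub>2, \<iota>).
     common_part \<gamma>\<^sub>1 \<gamma>\<^sub>2 I\<^sub>1 I\<^sub>2 \<iota> \<and> \<iota> \<in> extensional I\<^sub>1 \<and>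
     (\<forall>J\<^sub>1 J\<^sub>2 \<kappa>. common_part \<gamma>\<^sub>1 \<gamma>\<^sub>2 J\<^sub>1 J\<^sub>2 \<kappa> \<and> I\<^sub>1 \<subseteq> J\<^sub>1 \<and> I\<^sub>2 \<subseteq> J\<^sub>2 \<and> (\<forall>x\<in>I\<^sub>1. \<kappa> x = \<iota> x)
        \<longrightarrow> J\<^sub>1 = I\<^sub>1 \<and> J\<^sub>2 = I\<^sub>2)}"

definition crossings ::
    "(real \<Rightarrow> 'b) \<Rightarrow> (real \<Rightarrow> 'b) \<Rightarrow> (real set \<times> real set \<times> (real \<Rightarrow> real)) set" where
  "crossings \<gamma>\<^sub>1 \<gamma>\<^sub>2 = {(I\<^sub>1, I\<^sub>2, \<iota>) \<in> meets \<gamma>\<^sub>1 \<gamma>\<^sub>2. (I\<^sub>1 \<union> I\<^sub>2) \<inter> {0, 1} = {}}"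

definition cross_at_most :: "nat \<Rightarrow> (real \<Rightarrow> 'b) \<Rightarrow> (real \<Rightarrow> 'b) \<Rightarrow> bool" where
  "cross_at_most k \<gamma>\<^sub>1 \<gamma>\<^sub>2 \<longleftrightarrow> finite (crossings \<gamma>\<^sub>1 \<gamma>\<^sub>2) \<and> card (crossings \<gamma>\<^sub>1 \<gamma>\<^sub>2) \<le> k"

end

theory Submission
  imports Defs
begin

text \<open>
  Put the branch vertices at integer points of a parabola, draw every edge of the complete graph as a
  straight chord, and place the subdivision vertices so close to the nearer end of their chord that
  all proper intersections of chords lie between the two middle vertices. The part of a chord
  between an end and the subdivision vertices close to it is called a leg.

  A shortest path runs along one chord, along two chords with a common end, or along a leg, a full
  chord and another leg; a longer piece than a leg could be replaced by a detour around the other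
  side of a triangle. Its curve is thus an arc made of at most three segments. Meets of two arcs are
  bounded in number by any cover of their common points by connected sets. Two pairs of segments give
  four convex intersections. A leg meets no chord except those at its own end, which merges enough of
  the remaining intersections into connected sets to keep their number at most four in all cases.
\<close>

section \<open>Meets of arcs\<close>

text \<open>An arc is a homeomorphism onto its image, so the preimage of \<open>C\<close> is its
  continuous image under the inverse; connected sets of reals are intervals.\<close>

lemma connected_arc_vimage:
  fixes g :: "real \<Rightarrow> 'a::t2_space"
  assumes "arc g" "Topological_Spaces.connected C" "C \<subseteq> path_image g"
  shows "is_interval {x \<in> {0..1}. g x \<in> C}"
proof -
  obtain h where h: "homeomorphism {0..1} (path_image g) g h"
    using homeomorphism_arc[OF \<open>arc g\<close>] .
  have "{x \<in> {0..1}. g x \<in> C} = h ` C"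
  proof
    show "{x \<in> {0..1}. g x \<in> C} \<subseteq> h ` C"
      using homeomorphism_apply1[OF h] by (force simp: image_iff)
    show "h ` C \<subseteq> {x \<in> {0..1}. g x \<in> C}"
    proof
      fix x assume "x \<in> h ` C"
      then obtain c where c: "c \<in> C" "x = h c" by blast
      then have "c \<in> path_image g" using assms(3) by blast
      then show "x \<in> {x \<in> {0..1}. g x \<in> C}"
        using homeomorphism_apply2[OF h, of c] homeomorphism_image2[OF h] c by auto
    qed
  qed
  moreover have "Topological_Spaces.connected (h ` C)"
    using homeomorphism_cont2[OF h] assms(2,3)
    by (intro connected_continuous_image) (auto intro: continuous_on_subset)
  ultimately show ?thesis
    by (simp add: is_interval_connected_1)
qed

lemma arc_inj: "arc g \<Longrightarrow> x \<in> {0..1} \<Longrightarrow> y \<in> {0..1} \<Longrightarrow> g x = g y \<Longrightarrow> x = y"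
  by (auto simp: arc_def inj_on_def)

text \<open>Both values are parameters at which the injective \<open>g2\<close> passes through
  \<open>g1 x\<close>, so the bijection of a common part is forced pointwise.\<close>

lemma common_part_unique:
  assumes "arc g2" "common_part g1 g2 I1 I2 f" "common_part g1 g2 J1 J2 h" "x \<in> I1" "x \<in> J1"
  shows "f x = h x"
proof (rule arc_inj[OF \<open>arc g2\<close>])
  have fh: "f ` I1 = I2" "h ` J1 = J2" "I2 \<subseteq> {0..1}" "J2 \<subseteq> {0..1}"
    using assms(2,3) by (simp_all add: common_part_def bij_betw_def)
  then show "f x \<in> {0..1}" "h x \<in> {0..1}" using assms(4,5) by blast+
  show "g2 (f x) = g2 (h x)"
    using assms(2-5) unfolding common_part_def by metis
qed

text \<open>The bijections agree on the overlap and can be glued. The shared parameter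
  \<open>x\<close> keeps both unions connected: \<open>f x\<close> lies in \<open>I2\<close> and in
  \<open>J2\<close>.\<close>

lemma common_part_Un:
  assumes "arc g1" "arc g2"
    and f: "common_part g1 g2 I1 I2 f" and h: "common_part g1 g2 J1 J2 h"
    and x: "x \<in> I1" "x \<in> J1"
  shows "common_part g1 g2 (I1 \<union> J1) (I2 \<union> J2) (\<lambda>y. if y \<in> I1 then f y else h y)"
proof -
  let ?k = "\<lambda>y. if y \<in> I1 then f y else h y"
  have k: "?k y = h y" if "y \<in> J1" for y
    using common_part_unique[OF \<open>arc g2\<close> f h _ that] by auto
  have F: "f ` I1 = I2" "h ` J1 = J2" using f h by (auto simp: common_part_def bij_betw_def)
  have "f x = h x" using k[OF x(2)] x by simp
  then have "f x \<in> I2 \<inter> J2" "x \<in> I1 \<inter> J1"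
    using x F by (simp, metis imageI, simp)
  moreover have "is_interval I1" "is_interval J1" "is_interval I2" "is_interval J2"
    using f h by (auto simp: common_part_def)
  ultimately have "is_interval (I1 \<union> J1)" "is_interval (I2 \<union> J2)"
    unfolding is_interval_connected_1 by (intro connected_Un; blast)+
  moreover have g: "g1 y = g2 (?k y)" if "y \<in> I1 \<union> J1" for y
    using that f h by (auto simp: common_part_def)
  moreover have sub: "I1 \<union> J1 \<subseteq> {0..1}" "I2 \<union> J2 \<subseteq> {0..1}" "I1 \<union> J1 \<noteq> {}" "I2 \<union> J2 \<noteq> {}"
    using f h by (auto simp: common_part_def)
  moreover have "?k ` (I1 \<union> J1) = I2 \<union> J2"
  proof -
    have "?k ` J1 = h ` J1" using k by (rule image_cong[OF refl])
    moreover have "?k ` I1 = f ` I1" by (rule image_cong) auto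
    ultimately show ?thesis by (simp only: image_Un F)
  qed
  moreover have "inj_on ?k (I1 \<union> J1)"
  proof (rule inj_onI)
    \<comment> \<open>The glued map inherits injectivity from \<open>g1\<close>, also for
      \<open>y\<close> and \<open>z\<close> from different pieces.\<close>
    fix y z assume yz: "y \<in> I1 \<union> J1" "z \<in> I1 \<union> J1" and "?k y = ?k z"
    then have "g1 y = g1 z" using g[OF yz(1)] g[OF yz(2)] by simp
    then show "y = z" using arc_inj[OF \<open>arc g1\<close>] sub(1) yz by blast
  qed
  ultimately show ?thesis
    unfolding common_part_def bij_betw_def by blast
qed

text \<open>Gluing turns maximality under extension into absorption: the union of the meet with a
  common part that shares a parameter extends the meet, hence adds nothing.\<close>

lemma meets_maximal:
  assumes "arc g1" "arc g2" "(I1, I2, f) \<in> meets g1 g2" "common_part g1 g2 J1 J2 h"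
    and "x \<in> I1" "x \<in> J1"
  shows "J1 \<subseteq> I1"
proof -
  have "common_part g1 g2 I1 I2 f"
    using assms by (auto simp: meets_def)
  note Un = common_part_Un[OF assms(1,2) this assms(4-6)]
  have "\<And>J1 J2 k. common_part g1 g2 J1 J2 k \<Longrightarrow> I1 \<subseteq> J1 \<Longrightarrow> I2 \<subseteq> J2 \<Longrightarrow> \<forall>x\<in>I1. k x = f x \<Longrightarrow> J1 = I1"
    using assms(3) unfolding meets_def by blast
  from this[OF Un] have "I1 \<union> J1 = I1" by simp
  then show ?thesis by auto
qed

text \<open>The two meets absorb each other, so their intervals agree; extensionality then settles
  the bijections outside them.\<close>

lemma meets_eqI:
  assumes "arc g1" "arc g2" "(I1, I2, f) \<in> meets g1 g2" "(J1, J2, h) \<in> meets g1 g2"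
    and "x \<in> I1" "x \<in> J1"
  shows "(I1, I2, f) = (J1, J2, h)"
proof -
  have c: "common_part g1 g2 I1 I2 f" "common_part g1 g2 J1 J2 h"
    and ext: "f \<in> extensional I1" "h \<in> extensional J1"
    using assms by (auto simp: meets_def)
  have 1: "I1 = J1"
    using meets_maximal[OF assms(1-3) c(2)] meets_maximal[OF assms(1,2,4) c(1)] assms by blast
  then have 2: "f = h"
    using ext common_part_unique[OF assms(2) c] by (intro extensionalityI[of f I1]) auto
  show ?thesis using c 1 2 by (auto simp: common_part_def bij_betw_def)
qed

text \<open>The source of common parts to compare meets with: the preimages of \<open>C\<close>
  under both arcs are intervals, and following \<open>g1\<close> by the inverse of \<open>g2\<close>
  matches their parameters.\<close>

lemma common_part_of_connected:
  fixes g1 g2 :: "real \<Rightarrow> 'b::t2_space"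
  assumes "arc g1" "arc g2" "Topological_Spaces.connected C" "C \<noteq> {}" "C \<subseteq> path_image g1 \<inter> path_image g2"
  shows "\<exists>f. common_part g1 g2 {x \<in> {0..1}. g1 x \<in> C} {x \<in> {0..1}. g2 x \<in> C} f"
proof -
  have bij: "bij_betw g {x \<in> {0..1}. g x \<in> C} C"
    if "arc g" "C \<subseteq> path_image g" for g :: "real \<Rightarrow> 'b"
    unfolding bij_betw_def
  proof
    show "inj_on g {x \<in> {0..1}. g x \<in> C}" using arc_inj[OF \<open>arc g\<close>] by (simp add: inj_on_def)
    show "g ` {x \<in> {0..1}. g x \<in> C} = C" using that(2) unfolding path_image_def by blast
  qed
  have bij1: "bij_betw g1 {x \<in> {0..1}. g1 x \<in> C} C" and bij2: "bij_betw g2 {x \<in> {0..1}. g2 x \<in> C} C"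
    by (rule bij; use assms in blast)+
  define f where "f = inv_into {x \<in> {0..1}. g2 x \<in> C} g2 \<circ> g1"
  have "bij_betw f {x \<in> {0..1}. g1 x \<in> C} {x \<in> {0..1}. g2 x \<in> C}"
    unfolding f_def using bij1 bij_betw_inv_into[OF bij2] by (rule bij_betw_trans)
  moreover have "g1 x = g2 (f x)" if "g1 x \<in> C" for x
    using bij2 that unfolding f_def by (simp add: bij_betw_inv_into_right)
  moreover have "{x \<in> {0..1}. g1 x \<in> C} \<noteq> {}" "{x \<in> {0..1}. g2 x \<in> C} \<noteq> {}"
    using bij1 bij2 \<open>C \<noteq> {}\<close> by (auto simp: bij_betw_def)
  moreover have "is_interval {x \<in> {0..1}. g1 x \<in> C}" "is_interval {x \<in> {0..1}. g2 x \<in> C}"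
    by (rule connected_arc_vimage; use assms in blast)+
  ultimately have "common_part g1 g2 {x \<in> {0..1}. g1 x \<in> C} {x \<in> {0..1}. g2 x \<in> C} f"
    unfolding common_part_def by blast
  then show ?thesis by (rule exI[of _ f])
qed

text \<open>Send each meet to a member of the cover containing one of its points. That member yields
  a common part, which every meet touching it absorbs, so meets sent to the same member share a
  parameter and coincide. Crossings are particular meets.\<close>

lemma cross_at_most_of_connected_cover:
  fixes g1 g2 :: "real \<Rightarrow> 'b::t2_space"
  assumes "arc g1" "arc g2" and "finite F" "card F \<le> k"
    and F: "path_image g1 \<inter> path_image g2 = \<Union>F" "\<And>C. C \<in> F \<Longrightarrow> Topological_Spaces.connected C"
  shows "cross_at_most k g1 g2"
proof -
  have "\<exists>C\<in>F. \<exists>x\<in>fst m. x \<in> {0..1} \<and> g1 x \<in> C" if "m \<in> meets g1 g2" for m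
  proof -
    obtain I1 I2 f where m: "m = (I1, I2, f)" by (cases m)
    then have c: "common_part g1 g2 I1 I2 f" using that by (auto simp: meets_def)
    then obtain x where x: "x \<in> I1" by (auto simp: common_part_def)
    with c have "x \<in> {0..1}" "f x \<in> {0..1}" "g1 x = g2 (f x)"
      by (auto simp: common_part_def bij_betw_def)
    then have "g1 x \<in> \<Union>F" unfolding F(1)[symmetric] path_image_def
      by (metis IntI imageI)
    then show ?thesis using x \<open>x \<in> {0..1}\<close> m by auto
  qed
  then obtain c where c: "\<And>m. m \<in> meets g1 g2 \<Longrightarrow> c m \<in> F"
    "\<And>m. m \<in> meets g1 g2 \<Longrightarrow> \<exists>x\<in>fst m. x \<in> {0..1} \<and> g1 x \<in> c m"
    by metis
  have "inj_on c (meets g1 g2)"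
  proof
    fix m m' assume m: "m \<in> meets g1 g2" "m' \<in> meets g1 g2" and eq: "c m = c m'"
    obtain I1 I2 f J1 J2 h where mm: "m = (I1, I2, f)" "m' = (J1, J2, h)" by (cases m, cases m')
    obtain x where x: "x \<in> I1" "x \<in> {0..1}" "g1 x \<in> c m"
      using c(2)[OF m(1)] by (auto simp: mm)
    obtain y where y: "y \<in> J1" "y \<in> {0..1}" "g1 y \<in> c m"
      using c(2)[OF m(2)] unfolding eq by (auto simp: mm)
    obtain k where k: "common_part g1 g2 {x \<in> {0..1}. g1 x \<in> c m} {x \<in> {0..1}. g2 x \<in> c m} k"
      using common_part_of_connected[OF assms(1,2), of "c m"] F c(1)[OF m(1)] x by blast
    have "x \<in> J1"
      using meets_maximal[OF assms(1,2) m(2)[unfolded mm] k y(1)] x y by auto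
    then show "m = m'" using meets_eqI[OF assms(1,2)] m x unfolding mm by metis
  qed
  moreover have "c ` meets g1 g2 \<subseteq> F" using c(1) by blast
  ultimately have "finite (meets g1 g2)" "card (meets g1 g2) \<le> card F"
    using \<open>finite F\<close> by (rule inj_on_finite, intro card_inj_on_le)
  moreover have "crossings g1 g2 \<subseteq> meets g1 g2" unfolding crossings_def by blast
  ultimately show ?thesis
    unfolding cross_at_most_def using \<open>card F \<le> k\<close> finite_subset card_mono[of "meets g1 g2" "crossings g1 g2"]
    by (metis le_trans)
qed

section \<open>Chords of a parabola\<close>

text \<open>A list bounds the number of sets without asking that they be distinct or nonempty;
  pieces may coincide in degenerate positions.\<close>

definition covered_by_connected :: "nat \<Rightarrow> 'b::topological_space set \<Rightarrow> bool" where
  "covered_by_connected k A \<longleftrightarrow>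
     (\<exists>Cs. length Cs \<le> k \<and> A = \<Union>(set Cs) \<and> (\<forall>C\<in>set Cs. Topological_Spaces.connected C))"

lemma covered_by_connectedI:
  "A = \<Union>(set Cs) \<Longrightarrow> length Cs \<le> k \<Longrightarrow> (\<And>C. C \<in> set Cs \<Longrightarrow> Topological_Spaces.connected C)
   \<Longrightarrow> covered_by_connected k A"
  unfolding covered_by_connected_def by blast

locale parabola_chords =
  fixes V :: "'a set" and r :: "'a \<Rightarrow> nat" and N :: nat
  assumes inj: "inj_on r V" and bound: "\<And>u. u \<in> V \<Longrightarrow> r u \<le> N"
begin

text \<open>No three points of a parabola are collinear, and integer abscissas make this
  quantitative, as used in \<open>leg_meets_chord\<close>.\<close>

definition corner :: "'a \<Rightarrow> real \<times> real" where
  "corner u = (real (r u), (real (r u))\<^sup>2)"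

definition chord :: "'a \<Rightarrow> 'a \<Rightarrow> real \<Rightarrow> real \<times> real" where
  "chord u v s = (1 - s) *\<^sub>R corner u + s *\<^sub>R corner v"

text \<open>Given by parameters of the full chord, so that pieces of one chord are compared through
  parameters. For \<open>b < a\<close> the set is empty.\<close>

definition seg :: "'a \<Rightarrow> 'a \<Rightarrow> real \<Rightarrow> real \<Rightarrow> (real \<times> real) set" where
  "seg u v a b = chord u v ` {a..b}"

text \<open>Corners have integer abscissas bounded by \<open>N\<close>, so two chords without a common end can only
  meet at parameters at least \<open>1 / (N\<^sup>2 + 1)\<close>, measured from either end.\<close>

definition \<delta> :: real where
  "\<delta> = 1 / ((real N)\<^sup>2 + 3)"

lemma delta_pos: "0 < \<delta>" and delta_le: "\<delta> < 1/2"
proof -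
  have "0 \<le> (real N)\<^sup>2" by simp
  then have "2 < (real N)\<^sup>2 + 3" by linarith
  then show "0 < \<delta>" "\<delta> < 1/2" by (auto simp: \<delta>_def field_simps)
qed

lemma chord_0 [simp]: "chord u v 0 = corner u" and chord_1 [simp]: "chord u v 1 = corner v"
  by (auto simp: chord_def)

lemma chord_swap: "chord v u (1 - s) = chord u v s"
  by (simp add: chord_def add.commute)

lemma chord_affine:
  "chord u v ((1 - l) * a + l * b) = (1 - l) *\<^sub>R chord u v a + l *\<^sub>R chord u v b"
  by (simp add: chord_def corner_def prod_eq_iff algebra_simps)

lemma seg_swap: "seg v u a b = seg u v (1 - b) (1 - a)"
proof -
  have "seg v u a b = chord u v ` ((\<lambda>s. 1 - s) ` {a..b})"
    unfolding seg_def image_image chord_swap by (rule image_cong) (metis chord_swap diff_diff_eq2 add_diff_cancel_left', simp)+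
  then show ?thesis by (simp add: seg_def)
qed

lemma seg_eq_closed_segment:
  assumes "a \<le> b"
  shows "seg u v a b = closed_segment (chord u v a) (chord u v b)"
proof -
  have "{a..b} = (\<lambda>l. (1 - l) * a + l * b) ` {0..1}"
    using closed_segment_image_interval[of a b] assms by (simp add: closed_segment_eq_real_ivl)
  then show ?thesis
    by (simp add: seg_def closed_segment_image_interval image_image chord_affine)
qed

lemma convex_seg: "convex (seg u v a b)"
proof (cases "a \<le> b")
  case True
  then show ?thesis by (simp only: seg_eq_closed_segment convex_closed_segment)
qed (simp add: seg_def)

lemma corner_in_seg: "0 \<le> b \<Longrightarrow> corner u \<in> seg u v 0 b" "a \<le> 1 \<Longrightarrow> corner v \<in> seg u v a 1"
  unfolding seg_def by (rule image_eqI[of _ _ 0]; simp) (rule image_eqI[of _ _ 1]; simp)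

lemma seg_union: "a \<le> b \<Longrightarrow> b \<le> c \<Longrightarrow> seg u v a b \<union> seg u v b c = seg u v a c"
  unfolding seg_def image_Un[symmetric] by (simp add: ivl_disj_un_two_touch)

lemma r_eq_iff: "u \<in> V \<Longrightarrow> v \<in> V \<Longrightarrow> real (r u) = real (r v) \<longleftrightarrow> u = v"
  using inj by (auto dest: inj_onD)

lemma chord_inj:
  assumes "u \<in> V" "v \<in> V" "u \<noteq> v" "chord u v s = chord u v s'"
  shows "s = s'"
proof -
  have "(s - s') * (real (r v) - real (r u)) = 0"
    using assms(4) by (simp add: chord_def corner_def algebra_simps)
  then show ?thesis using assms r_eq_iff[of u v] by auto
qed

text \<open>The left-hand side evaluates, along the chord from \<open>u\<close> to \<open>w\<close>, an affine function
  vanishing on the line through the corners of \<open>x\<close> and \<open>y\<close>.\<close>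

lemma chord_meets_line:
  assumes "chord u w s = chord x y s'"
  shows "(1 - s) * ((real (r u) - r x) * (real (r u) - r y)) + s * ((real (r w) - r x) * (real (r w) - r y)) = 0"
proof -
  have 1: "(1 - s) * real (r u) + s * real (r w) = (1 - s') * real (r x) + s' * real (r y)"
   and 2: "(1 - s) * (real (r u))\<^sup>2 + s * (real (r w))\<^sup>2 = (1 - s') * (real (r x))\<^sup>2 + s' * (real (r y))\<^sup>2"
    using assms by (auto simp: chord_def corner_def)
  have "(1 - s) * ((real (r u) - r x) * (real (r u) - r y)) + s * ((real (r w) - r x) * (real (r w) - r y))
    = ((1 - s) * (real (r u))\<^sup>2 + s * (real (r w))\<^sup>2) - (real (r x) + r y) * ((1 - s) * real (r u) + s * real (r w))
      + real (r x) * r y"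
    by (simp add: algebra_simps power2_eq_square)
  also have "\<dots> = 0"
    unfolding 1 2 by (simp add: algebra_simps power2_eq_square)
  finally show ?thesis .
qed

text \<open>The affine function of \<open>chord_meets_line\<close> for the line through
  \<open>u\<close> and \<open>w\<close> vanishes at \<open>u\<close> but not at \<open>v\<close>, so
  its only zero on the chord \<open>uv\<close> is at \<open>u\<close>.\<close>

lemma chords_adjacent:
  assumes "u \<in> V" "v \<in> V" "w \<in> V" "u \<noteq> v" "u \<noteq> w" "v \<noteq> w" "chord u v s = chord u w s'"
  shows "s = 0"
proof -
  have "s * ((real (r v) - r u) * (real (r v) - r w)) = 0"
    using chord_meets_line[OF assms(7)] by simp
  then show ?thesis
    using r_eq_iff[of v u] r_eq_iff[of v w] assms(1-6) by simp
qed

text \<open>For \<open>u\<close> different from \<open>x\<close> and \<open>y\<close>, the affine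
  function of \<open>chord_meets_line\<close> has absolute value at least 1 at \<open>u\<close> and
  at most \<open>N * N\<close> at \<open>w\<close>. A zero therefore needs a parameter of at least
  \<open>1 / (N * N + 1)\<close>, which exceeds \<delta>.\<close>

lemma leg_meets_chord:
  assumes V: "u \<in> V" "w \<in> V" "x \<in> V" "y \<in> V" and s: "0 \<le> s" "s \<le> \<delta>"
    and eq: "chord u w s = chord x y s'"
  shows "u = x \<or> u = y"
proof (rule ccontr)
  assume ne: "\<not> (u = x \<or> u = y)"
  \<comment> \<open>An integer, so that being nonzero already gives absolute value at least
    1.\<close>
  define A where "A = (int (r u) - r x) * (int (r u) - r y)"
  define B where "B = (real (r w) - r x) * (real (r w) - r y)"
  have "A \<noteq> 0" using ne V inj by (auto simp: A_def dest: inj_onD)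
  then have A: "1 \<le> \<bar>real_of_int A\<bar>" by linarith
  have B: "\<bar>B\<bar> \<le> real N * real N"
    unfolding B_def abs_mult using bound[OF V(2)] bound[OF V(3)] bound[OF V(4)]
    by (intro mult_mono) auto
  have "(1 - s) * real_of_int A = - (s * B)"
    using chord_meets_line[OF eq] unfolding A_def B_def by simp
  then have "\<bar>1 - s\<bar> * \<bar>real_of_int A\<bar> = \<bar>s\<bar> * \<bar>B\<bar>"
    by (simp only: abs_mult[symmetric] abs_minus_cancel)
  then have eq': "(1 - s) * \<bar>real_of_int A\<bar> = s * \<bar>B\<bar>"
    using s delta_le by simp
  have "(1 - s) * 1 \<le> (1 - s) * \<bar>real_of_int A\<bar>"
    using A s delta_le by (intro mult_left_mono) auto
  also have "\<dots> \<le> s * (real N * real N)"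
    unfolding eq' using B s by (intro mult_left_mono) auto
  finally have "1 - s \<le> s * (real N * real N)" by simp
  then have "1 \<le> s * ((real N)\<^sup>2 + 1)" by (simp add: algebra_simps power2_eq_square)
  also have "\<dots> \<le> \<delta> * ((real N)\<^sup>2 + 1)" using s by (intro mult_right_mono) auto
  also have "\<dots> < 1"
  proof -
    have "0 \<le> (real N)\<^sup>2" by simp
    then have "0 < (real N)\<^sup>2 + 3" by linarith
    then show ?thesis by (simp add: \<delta>_def)
  qed
  finally show False by simp
qed

text \<open>Otherwise \<open>u = y\<close> by \<open>leg_meets_chord\<close>. Seen from
  \<open>u\<close>, the common point then has parameter \<open>1 - s'\<close>, larger than \<delta>
  because \<delta> is below 1/2. On the same chord this contradicts \<open>s\<close> being at most
  \<delta>; on another chord the point would have to be \<open>u\<close> itself.\<close>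

lemma legs_meet:
  assumes V: "u \<in> V" "w \<in> V" "x \<in> V" "y \<in> V" and ne: "u \<noteq> w" "x \<noteq> y"
    and s: "0 \<le> s" "s \<le> \<delta>" "0 \<le> s'" "s' \<le> \<delta>"
    and eq: "chord u w s = chord x y s'"
  shows "u = x"
proof (rule ccontr)
  assume "u \<noteq> x"
  then have [simp]: "y = u" using leg_meets_chord[OF V s(1,2) eq] by auto
  have eq': "chord u w s = chord u x (1 - s')" using eq by (simp add: chord_swap)
  have "1 - s' > \<delta>"
    using s delta_le delta_pos by linarith
  show False
  proof (cases "w = x")
    case True
    then show False using chord_inj[of u x s "1 - s'"] eq' s \<open>1 - s' > \<delta>\<close> V ne by auto
  next
    case False
    then have "1 - s' = 0" using chords_adjacent[of u x w "1 - s'" s] eq' V ne by auto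
    then show False using \<open>1 - s' > \<delta>\<close> delta_pos by auto
  qed
qed

section \<open>Intersections of the possible images of shortest paths\<close>

definition two_segments :: "(real \<times> real) set \<Rightarrow> bool" where
  "two_segments X \<longleftrightarrow> (\<exists>u v w a b. u \<in> V \<and> v \<in> V \<and> w \<in> V \<and> u \<noteq> v \<and> u \<noteq> w \<and> v \<noteq> w \<and>
     0 \<le> a \<and> a \<le> 1 \<and> 0 \<le> b \<and> b \<le> 1 \<and> X = seg u v 0 a \<union> seg u w 0 b)"

text \<open>The two legs may point to the same corner, \<open>w = z\<close>.\<close>

definition chord_with_legs :: "(real \<times> real) set \<Rightarrow> bool" where
  "chord_with_legs X \<longleftrightarrow> (\<exists>u v w z a b. u \<in> V \<and> v \<in> V \<and> w \<in> V \<and> z \<in> V \<and> u \<noteq> v \<and> u \<noteq> w \<and> v \<noteq> z \<and>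
     0 \<le> a \<and> a \<le> \<delta> \<and> 0 \<le> b \<and> b \<le> \<delta> \<and> X = seg u w 0 a \<union> seg u v 0 1 \<union> seg v z 0 b)"

lemma leg_inter_seg:
  assumes "u \<in> V" "w \<in> V" "x \<in> V" "y \<in> V" "a \<le> \<delta>" "seg u w 0 a \<inter> seg x y c d \<noteq> {}"
  shows "u = x \<or> u = y"
proof -
  obtain s s' where "s \<in> {0..a}" "chord u w s = chord x y s'"
    using assms(6) unfolding seg_def by blast
  then show ?thesis using leg_meets_chord[of u w x y s s'] assms by auto
qed

lemma leg_inter_leg:
  assumes "u \<in> V" "w \<in> V" "x \<in> V" "y \<in> V" "u \<noteq> w" "x \<noteq> y" "a \<le> \<delta>" "b \<le> \<delta>"
    "seg u w 0 a \<inter> seg x y 0 b \<noteq> {}"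
  shows "u = x"
proof -
  obtain s s' where "s \<in> {0..a}" "s' \<in> {0..b}" "chord u w s = chord x y s'"
    using assms(9) unfolding seg_def by blast
  then show ?thesis using legs_meet[of u w x y s s'] assms by auto
qed

lemma connected_seg_inter: "Topological_Spaces.connected (seg u v a b \<inter> seg x y c d)"
  by (intro convex_connected convex_Int convex_seg)

text \<open>A leg starting at \<open>x\<close> meets both segments in sets containing that corner.
  Any other leg only meets a chord that ends at \<open>u\<close>, and as \<open>y\<close> and
  \<open>z\<close> differ, one of the two intersections is empty.\<close>

lemma connected_leg_inter_two_segments:
  assumes V: "u \<in> V" "w \<in> V" "x \<in> V" "y \<in> V" "z \<in> V" and "y \<noteq> z" "0 \<le> a" "a \<le> \<delta>" "0 \<le> c" "0 \<le> d"
  shows "Topological_Spaces.connected (seg u w 0 a \<inter> (seg x y 0 c \<union> seg x z 0 d))"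
proof (cases "u = x")
  case True
  then have "corner u \<in> (seg u w 0 a \<inter> seg x y 0 c) \<inter> (seg u w 0 a \<inter> seg x z 0 d)"
    using assms by (auto intro: corner_in_seg)
  then show ?thesis unfolding Int_Un_distrib
    by (intro connected_Un connected_seg_inter) auto
next
  case False
  then have "seg u w 0 a \<inter> seg x y 0 c = {} \<or> seg u w 0 a \<inter> seg x z 0 d = {}"
    using leg_inter_seg[of u w x y a 0 c] leg_inter_seg[of u w x z a 0 d] assms by blast
  then show ?thesis unfolding Int_Un_distrib
    using connected_seg_inter[of u w 0 a x y 0 c] connected_seg_inter[of u w 0 a x z 0 d] by auto
qed

lemma inter_two_segments:
  assumes "two_segments X" "two_segments Y"
  shows "covered_by_connected 4 (X \<inter> Y)"
proof -
  obtain u v w a b x y z c d where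
    "X = seg u v 0 a \<union> seg u w 0 b" "Y = seg x y 0 c \<union> seg x z 0 d"
    using assms unfolding two_segments_def by blast
  then show ?thesis
    by (intro covered_by_connectedI[of _ "[seg u v 0 a \<inter> seg x y 0 c, seg u v 0 a \<inter> seg x z 0 d,
          seg u w 0 b \<inter> seg x y 0 c, seg u w 0 b \<inter> seg x z 0 d]"])
       (auto intro: connected_seg_inter)
qed

text \<open>The full chord meets the two segments in two convex sets, and each leg contributes a
  single connected set, which makes four.\<close>

lemma inter_chord_with_legs_two_segments:
  assumes "chord_with_legs X" "two_segments Y"
  shows "covered_by_connected 4 (X \<inter> Y)"
proof -
  obtain u v w z a b where X: "u \<in> V" "v \<in> V" "w \<in> V" "z \<in> V"
    "0 \<le> a" "a \<le> \<delta>" "0 \<le> b" "b \<le> \<delta>" "X = seg u w 0 a \<union> seg u v 0 1 \<union> seg v z 0 b"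
    using assms unfolding chord_with_legs_def by blast
  obtain x y y' c d where Y: "x \<in> V" "y \<in> V" "y' \<in> V" "y \<noteq> y'" "0 \<le> c" "0 \<le> d"
    "Y = seg x y 0 c \<union> seg x y' 0 d"
    using assms unfolding two_segments_def by blast
  have "Topological_Spaces.connected (seg u w 0 a \<inter> Y)" "Topological_Spaces.connected (seg v z 0 b \<inter> Y)"
    unfolding Y(7) using X Y by (intro connected_leg_inter_two_segments; simp)+
  moreover have "X \<inter> Y = \<Union> (set [seg u v 0 1 \<inter> seg x y 0 c, seg u v 0 1 \<inter> seg x y' 0 d,
          seg u w 0 a \<inter> Y, seg v z 0 b \<inter> Y])"
    unfolding X(9) Y(7) by auto
  ultimately show ?thesis
    by (elim covered_by_connectedI) (auto intro: connected_seg_inter)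
qed

text \<open>The intersection is even connected. Whenever a leg meets a chord or another leg, the
  corner at its foot lies in that intersection and on both full chords, so all pieces hang on the
  convex set \<open>?C \<inter> ?C'\<close>.\<close>

lemma inter_chord_with_legs:
  assumes "chord_with_legs X" "chord_with_legs Y"
  shows "covered_by_connected 4 (X \<inter> Y)"
proof -
  obtain u v w z a b where X: "u \<in> V" "v \<in> V" "w \<in> V" "z \<in> V" "u \<noteq> v" "u \<noteq> w" "v \<noteq> z"
    "0 \<le> a" "a \<le> \<delta>" "0 \<le> b" "b \<le> \<delta>" "X = seg u w 0 a \<union> seg u v 0 1 \<union> seg v z 0 b"
    using assms unfolding chord_with_legs_def by blast
  obtain u' v' w' z' a' b' where Y: "u' \<in> V" "v' \<in> V" "w' \<in> V" "z' \<in> V" "u' \<noteq> v'" "u' \<noteq> w'" "v' \<noteq> z'"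
    "0 \<le> a'" "a' \<le> \<delta>" "0 \<le> b'" "b' \<le> \<delta>" "Y = seg u' w' 0 a' \<union> seg u' v' 0 1 \<union> seg v' z' 0 b'"
    using assms unfolding chord_with_legs_def by blast
  let ?C = "seg u v 0 1" and ?L = "seg u w 0 a" and ?M = "seg v z 0 b"
  let ?C' = "seg u' v' 0 1" and ?L' = "seg u' w' 0 a'" and ?M' = "seg v' z' 0 b'"
  have in_seg: "corner u \<in> ?C" "corner v \<in> ?C" "corner u' \<in> ?C'" "corner v' \<in> ?C'"
    "corner u \<in> ?L" "corner v \<in> ?M" "corner u' \<in> ?L'" "corner v' \<in> ?M'"
    using X Y by (simp_all add: corner_in_seg)
  define S where "S = {?L \<inter> ?C', ?M \<inter> ?C', ?L' \<inter> ?C, ?M' \<inter> ?C, ?L \<inter> ?L', ?L \<inter> ?M', ?M \<inter> ?L', ?M \<inter> ?M'}"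
  \<comment> \<open>Empty intersections are dropped, since every member has to touch
    \<open>?C \<inter> ?C'\<close> for the union to be connected.\<close>
  define B where "B = S - {{}}"
  have "(?C \<inter> ?C') \<inter> D \<noteq> {}" if "D \<in> B" for D
  proof -
    have "corner u \<in> ?C'" if "?L \<inter> ?C' \<noteq> {}"
      using leg_inter_seg[OF _ _ _ _ _ that] X Y in_seg by metis
    moreover have "corner v \<in> ?C'" if "?M \<inter> ?C' \<noteq> {}"
      using leg_inter_seg[OF _ _ _ _ _ that] X Y in_seg by metis
    moreover have "corner u' \<in> ?C" if "?L' \<inter> ?C \<noteq> {}"
      using leg_inter_seg[OF _ _ _ _ _ that] X Y in_seg by metis
    moreover have "corner v' \<in> ?C" if "?M' \<inter> ?C \<noteq> {}"
      using leg_inter_seg[OF _ _ _ _ _ that] X Y in_seg by metis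
    moreover have "u = u'" if "?L \<inter> ?L' \<noteq> {}"
      using leg_inter_leg[OF _ _ _ _ _ _ _ _ that] X Y by metis
    moreover have "u = v'" if "?L \<inter> ?M' \<noteq> {}"
      using leg_inter_leg[OF _ _ _ _ _ _ _ _ that] X Y by metis
    moreover have "v = u'" if "?M \<inter> ?L' \<noteq> {}"
      using leg_inter_leg[OF _ _ _ _ _ _ _ _ that] X Y by metis
    moreover have "v = v'" if "?M \<inter> ?M' \<noteq> {}"
      using leg_inter_leg[OF _ _ _ _ _ _ _ _ that] X Y by metis
    ultimately have "(?C \<inter> ?C') \<inter> D \<noteq> {}" if "D \<noteq> {}" "D \<in> S"
      using that(2,1) in_seg unfolding S_def by (elim insertE) (metis IntI emptyE)+
    then show ?thesis using that unfolding B_def by blast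
  qed
  moreover have "Topological_Spaces.connected D" if "D \<in> B" for D
    using that unfolding B_def S_def by (elim DiffE insertE emptyE) (simp_all only: connected_seg_inter)
  ultimately have "Topological_Spaces.connected (?C \<inter> ?C' \<union> \<Union>B)"
    by (intro connected_Un_UN connected_seg_inter)
  moreover have "X \<inter> Y = ?C \<inter> ?C' \<union> \<Union>B"
  proof -
    have "\<Union>B = \<Union>S" by (auto simp: B_def)
    also have "?C \<inter> ?C' \<union> \<Union>S = X \<inter> Y"
      unfolding X(12) Y(12) S_def
      by (simp only: Union_insert Union_empty Int_Un_distrib Int_Un_distrib2 Un_empty_left Un_empty_right Un_ac Int_ac)
    finally show ?thesis by simp
  qed
  ultimately show ?thesis
    by (intro covered_by_connectedI[of _ "[X \<inter> Y]"]) auto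
qed

lemma inter_seg:
  assumes "(\<exists>x y c d. Y = seg x y c d) \<or> two_segments Y \<or> chord_with_legs Y"
  shows "covered_by_connected 4 (seg u v a b \<inter> Y)"
  using assms
proof (elim disjE exE)
  fix x y c d assume "Y = seg x y c d"
  then show ?thesis
    using connected_seg_inter by (intro covered_by_connectedI[of _ "[seg u v a b \<inter> Y]"]) auto
next
  assume "two_segments Y"
  then obtain x y z c d where "Y = seg x y 0 c \<union> seg x z 0 d"
    unfolding two_segments_def by blast
  then show ?thesis
    by (intro covered_by_connectedI[of _ "[seg u v a b \<inter> seg x y 0 c, seg u v a b \<inter> seg x z 0 d]"])
       (auto intro: connected_seg_inter)
next
  assume "chord_with_legs Y"
  then obtain x y w z c d where "Y = seg x w 0 c \<union> seg x y 0 1 \<union> seg y z 0 d"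
    unfolding chord_with_legs_def by blast
  then show ?thesis
    by (intro covered_by_connectedI[of _ "[seg u v a b \<inter> seg x w 0 c, seg u v a b \<inter> seg x y 0 1,
          seg u v a b \<inter> seg y z 0 d]"])
       (auto intro: connected_seg_inter)
qed

lemma inter_covered:
  assumes X: "(\<exists>u v a b. X = seg u v a b) \<or> two_segments X \<or> chord_with_legs X"
    and Y: "(\<exists>x y c d. Y = seg x y c d) \<or> two_segments Y \<or> chord_with_legs Y"
  shows "covered_by_connected 4 (X \<inter> Y)"
  using X Y inter_seg[OF X] inter_seg[OF Y] inter_two_segments[of X Y]
    inter_chord_with_legs_two_segments[of X Y] inter_chord_with_legs_two_segments[of Y X]
    inter_chord_with_legs[of X Y]
  by (elim disjE exE) (simp_all add: Int_commute)

end

section \<open>Shortest paths in subdivided complete graphs\<close>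

lemma length_vwalk_to_vpath: "length (vwalk_to_vpath p) \<le> length p"
  by (induct p rule: vwalk_to_vpath_induct3) (auto intro: order_trans length_dropWhile_le le_SucI)

text \<open>Cutting the loops out of a walk does not lengthen it. Detours may thus repeat vertices
  when they are compared with a shortest path.\<close>

lemma shortest_path_le_vwalk:
  assumes "shortest_path G p" "vwalk q (with_proj G)" "hd q = hd p" "last q = last p"
  shows "length p \<le> length q"
proof -
  have "vpath (vwalk_to_vpath q) (with_proj G)" using assms(2) by (rule vwalk_to_vpath_vpath)
  moreover have "hd (vwalk_to_vpath q) = hd p" "last (vwalk_to_vpath q) = last p"
    using assms(3,4) by (simp_all add: vwalk_to_vpath_hd vwalk_to_vpath_last)
  ultimately have "vwalk_length p \<le> vwalk_length (vwalk_to_vpath q)"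
    using assms(1) unfolding shortest_path_def by blast
  then show ?thesis
    using length_vwalk_to_vpath[of q] assms(2) by (cases q) (auto simp: vwalk_def)
qed

text \<open>A shorter replacement for the tail would shorten the whole path; as it may pass through
  \<open>x\<close>, the comparison is made with walks.\<close>

lemma shortest_path_tail:
  assumes "shortest_path G (x # p)" "p \<noteq> []"
  shows "shortest_path G p"
proof -
  have x: "vwalk (x # p) (with_proj G)" "distinct p"
    using assms(1) by (auto simp: shortest_path_def vpath_def)
  then have p: "vwalk p (with_proj G)" "(x, hd p) \<in> arcs_ends (with_proj G)"
    using \<open>p \<noteq> []\<close> by (auto elim: vwalk_consE)
  have "vwalk_length p \<le> vwalk_length q"
    if q: "vpath q (with_proj G)" "hd q = hd p" "last q = last p" for q
  proof -
    have "q \<noteq> []" using q by (auto simp: vpath_def vwalk_def)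
    moreover have "vwalk (x # q) (with_proj G)"
      using q x p by (intro vwalk_consI) (auto simp: vpath_def vwalk_def)
    ultimately have "length (x # p) \<le> length (x # q)"
      using q assms by (intro shortest_path_le_vwalk) auto
    then show ?thesis by simp
  qed
  then show ?thesis using p x unfolding shortest_path_def vpath_def by blast
qed

lemma vwalk_append:
  assumes "vwalk p H" "vwalk q H" "(last p, hd q) \<in> arcs_ends H"
  shows "vwalk (p @ q) H"
  using assms by (auto simp: vwalk_def vwalk_arcs_append)

lemma upt_singleton: "[j..<Suc j] = [j]"
  by simp

lemma last_map_upt: "i \<le> j \<Longrightarrow> last (map f [i..<Suc j]) = f j"
  by simp

declare upt_Suc [simp del]

locale complete_subdivision =
  fixes V :: "'a::linorder set" and K :: "'a pair_pre_digraph" and t :: nat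
  assumes verts_K: "pverts K = V"
    and arcs_K: "parcs K = {(u, v). u \<in> V \<and> v \<in> V \<and> u \<noteq> v}"
begin

abbreviation G :: "'a sd_vertex pair_pre_digraph" where
  "G \<equiv> subdivide_all t K"

text \<open>The \<open>k\<close>-th vertex on the edge \<open>uv\<close> counted from \<open>u\<close>, without the restriction \<open>u < v\<close> on names.\<close>

definition sdv :: "'a \<Rightarrow> 'a \<Rightarrow> nat \<Rightarrow> 'a sd_vertex" where
  "sdv u v k = (if u < v then sd_point t u v k else sd_point t v u (Suc t - k))"

lemma sdv_0: "u \<noteq> v \<Longrightarrow> sdv u v 0 = Branch u"
  and sdv_end: "u \<noteq> v \<Longrightarrow> sdv u v (Suc t) = Branch v"
  by (auto simp: sdv_def sd_point_def)

lemma sdv_inner: "0 < k \<Longrightarrow> k \<le> t \<Longrightarrow> sdv u v k = (if u < v then Inner u v k else Inner v u (Suc t - k))"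
  by (auto simp: sdv_def sd_point_def)

lemma sdv_swap: "u \<noteq> v \<Longrightarrow> k \<le> Suc t \<Longrightarrow> sdv v u (Suc t - k) = sdv u v k"
  by (auto simp: sdv_def)

lemma sdv_cases:
  assumes "u \<noteq> v" "k \<le> Suc t"
  obtains "k = 0" "sdv u v k = Branch u" | "k = Suc t" "sdv u v k = Branch v"
  | "0 < k" "k \<le> t" "sdv u v k = (if u < v then Inner u v k else Inner v u (Suc t - k))"
  using assms sdv_0 sdv_end sdv_inner by (metis le_SucE neq0_conv)

text \<open>A subdivision vertex has exactly two names, one for each direction of its edge. The
  bounds on \<open>k\<close> exclude branch vertices, which are named by each incident edge.\<close>

lemma sdv_eqD:
  assumes "0 < k" "k \<le> t" "u \<noteq> v" "x \<noteq> y" "l \<le> Suc t" "sdv u v k = sdv x y l"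
  shows "x = u \<and> y = v \<and> l = k \<or> x = v \<and> y = u \<and> l = Suc t - k"
  using assms(4,5)
  by (cases rule: sdv_cases) (use assms in \<open>auto simp: sdv_inner split: if_splits\<close>)

lemma sdv_in_verts: "u \<in> V \<Longrightarrow> v \<in> V \<Longrightarrow> u \<noteq> v \<Longrightarrow> k \<le> Suc t \<Longrightarrow> sdv u v k \<in> pverts G"
  by (cases rule: sdv_cases[of u v k]) (auto simp: subdivide_all_def verts_K arcs_K)

text \<open>The second case is the graph with one vertex, where no edge exists that could name
  it.\<close>

lemma verts_cases:
  assumes "x \<in> pverts G"
  obtains u v k where "u \<in> V" "v \<in> V" "u \<noteq> v" "k \<le> Suc t" "x = sdv u v k"
  | u where "V = {u}" "x = Branch u"
proof -
  consider u where "u \<in> V" "x = Branch u"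
    | u v k where "u \<in> V" "v \<in> V" "u < v" "1 \<le> k" "k \<le> t" "x = Inner u v k"
    using assms by (auto simp: subdivide_all_def verts_K arcs_K)
  then show ?thesis
  proof cases
    case 1
    then show ?thesis
    proof (cases "V = {u}")
      case False
      then obtain v where "v \<in> V" "u \<noteq> v" using 1 by auto
      then show ?thesis using that(1)[of u v 0] 1 by (simp add: sdv_0)
    qed (use that 1 in auto)
  next
    case 2
    then show ?thesis using that(1)[of u v k] by (simp add: sdv_inner)
  qed
qed

text \<open>The symmetric closure in \<open>subdivide_all\<close> is absorbed by letting
  \<open>u\<close> and \<open>v\<close> occur in either order.\<close>

lemma arcs_G:
  "(x, y) \<in> parcs G \<longleftrightarrow>
     (\<exists>u v k. u \<in> V \<and> v \<in> V \<and> u \<noteq> v \<and> k \<le> t \<and> x = sdv u v k \<and> y = sdv u v (Suc k))"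
  (is "?L \<longleftrightarrow> ?R")
proof
  assume ?L
  then obtain u v k where uv: "u \<in> V" "v \<in> V" "u < v" "k \<le> t" and
    "x = sd_point t u v k \<and> y = sd_point t u v (Suc k) \<or> y = sd_point t u v k \<and> x = sd_point t u v (Suc k)"
    by (auto simp: subdivide_all_def arcs_K Let_def)
  then consider "x = sdv u v k" "y = sdv u v (Suc k)" | "y = sdv u v k" "x = sdv u v (Suc k)"
    by (auto simp: sdv_def)
  then show ?R
  proof cases
    case 1
    then show ?thesis using uv by blast
  next
    case 2
    then have "x = sdv v u (t - k)" "y = sdv v u (Suc (t - k))"
      using uv sdv_swap[of v u "t - k"] sdv_swap[of v u "Suc (t - k)"] by (auto simp: Suc_diff_le)
    then show ?thesis using uv by (metis diff_le_self less_irrefl)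
  qed
next
  assume ?R
  then obtain u v k where uv: "u \<in> V" "v \<in> V" "u \<noteq> v" "k \<le> t" "x = sdv u v k" "y = sdv u v (Suc k)"
    by blast
  show ?L
  proof (cases "u < v")
    case True
    then show ?thesis using uv by (auto simp: subdivide_all_def arcs_K Let_def sdv_def)
  next
    case False
    then have "v < u" using uv by auto
    moreover have "x = sd_point t v u (Suc (t - k))" "y = sd_point t v u (t - k)"
      using uv False by (simp_all add: sdv_def Suc_diff_le)
    ultimately have "(y, x) \<in> {(sd_point t u v k, sd_point t u v (k + 1)) |u v k. (u, v) \<in> parcs K \<and> u < v \<and> k \<le> t}"
      using uv unfolding mem_Collect_eq arcs_K
      by - (rule exI[of _ v], rule exI[of _ u], rule exI[of _ "t - k"], simp)
    then show ?thesis unfolding subdivide_all_def Let_def by simp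
  qed
qed

lemma arc_to_inner:
  assumes "(x, sdv u v i) \<in> parcs G" "u \<noteq> v" "0 < i" "i \<le> t"
  shows "x = sdv u v (i - 1) \<or> x = sdv u v (Suc i)"
proof -
  obtain a b k where k: "a \<noteq> b" "k \<le> t" "x = sdv a b k" "sdv u v i = sdv a b (Suc k)"
    using assms(1) unfolding arcs_G by blast
  from sdv_eqD[OF assms(3,4,2) k(1) _ k(4)] k(2)
  consider "a = u" "b = v" "Suc k = i" | "a = v" "b = u" "Suc k = Suc t - i" by auto
  then show ?thesis
  proof cases
    case 1
    then show ?thesis using k by auto
  next
    case 2
    then have "k = Suc t - Suc i" by simp
    then have "x = sdv u v (Suc i)" using 2 k sdv_swap[of u v "Suc i"] assms by simp
    then show ?thesis ..
  qed
qed

text \<open>Position \<open>t\<close> on the edge \<open>wu\<close> is the one next to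
  \<open>u\<close>; for \<open>t = 0\<close> it is \<open>Branch w\<close>.\<close>

lemma arc_to_branch:
  assumes "(x, Branch u) \<in> parcs G"
  obtains w where "w \<in> V" "w \<noteq> u" "x = sdv w u t"
proof -
  obtain a b k where k: "a \<in> V" "a \<noteq> b" "k \<le> t" "x = sdv a b k" "Branch u = sdv a b (Suc k)"
    using assms(1) unfolding arcs_G by blast
  then have "Suc k \<le> Suc t" by simp
  with k(2) have "Suc k = Suc t \<and> b = u"
    by (cases rule: sdv_cases) (use k(5) in \<open>auto split: if_splits\<close>)
  then show ?thesis using that k by auto
qed

lemma vwalk_run:
  assumes "u \<in> V" "v \<in> V" "u \<noteq> v" "i \<le> j" "j \<le> Suc t"
  shows "vwalk (map (sdv u v) [i..<Suc j]) (with_proj G)"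
  using \<open>i \<le> j\<close>
proof (induction i rule: inc_induct)
  case base
  then show ?case using sdv_in_verts[of u v j] assms by (simp add: vwalk_def upt_singleton)
next
  case (step n)
  have "map (sdv u v) [n..<Suc j] = sdv u v n # map (sdv u v) [Suc n..<Suc j]"
    using step by (simp add: upt_conv_Cons)
  moreover have "hd (map (sdv u v) [Suc n..<Suc j]) = sdv u v (Suc n)"
    using step by (simp add: upt_conv_Cons)
  moreover have "(sdv u v n, sdv u v (Suc n)) \<in> parcs G"
    unfolding arcs_G using assms step by - (rule exI[of _ u], rule exI[of _ v], rule exI[of _ n], simp)
  ultimately show ?case
    using step assms sdv_in_verts[of u v n] by (auto intro!: vwalk_consI)
qed

text \<open>The run stops at position \<open>t\<close>, so that \<open>Branch v\<close> occurs once,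
  as the head of \<open>p\<close>. For \<open>i = Suc t\<close> the run is empty.\<close>

lemma vwalk_run_append:
  assumes V: "u \<in> V" "v \<in> V" "u \<noteq> v" "i \<le> Suc t" and p: "vwalk p (with_proj G)" "hd p = Branch v"
  shows "vwalk (map (sdv u v) [i..<Suc t] @ p) (with_proj G)"
proof (cases "i = Suc t")
  case False
  then have i: "i \<le> t" using V by simp
  have "(sdv u v t, Branch v) \<in> parcs G"
    unfolding arcs_G using V by (metis order_refl sdv_end)
  then show ?thesis
    using i p vwalk_run[of u v i t] V by (intro vwalk_append) (auto simp: last_map_upt)
qed (use p in auto)

lemma hd_run: "u \<noteq> v \<Longrightarrow> hd (map (sdv u v) [0..<Suc j] @ p) = Branch u"
  by (simp add: upt_conv_Cons sdv_0)

lemma hd_run_append: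
  assumes "u \<noteq> v" "i \<le> Suc t" "hd p = Branch v"
  shows "hd (map (sdv u v) [i..<Suc t] @ p) = sdv u v i"
  using assms by (cases "i = Suc t") (auto simp: upt_conv_Cons sdv_end)

section \<open>The shape of shortest paths\<close>

definition spans_one :: "'a sd_vertex list \<Rightarrow> bool" where
  "spans_one p \<longleftrightarrow> (\<exists>u v i j. u \<in> V \<and> v \<in> V \<and> u \<noteq> v \<and> i < j \<and> j \<le> Suc t \<and>
     p = map (sdv u v) [i..<Suc j])"

text \<open>The common branch vertex \<open>u\<close> is position 0 of the second run. The bounds
  \<open>i \<le> t\<close> and \<open>1 \<le> j\<close> give each side at least one edge of the
  subdivision.\<close>

definition spans_two :: "'a sd_vertex list \<Rightarrow> bool" where
  "spans_two p \<longleftrightarrow> (\<exists>u v w i j. u \<in> V \<and> v \<in> V \<and> w \<in> V \<and> u \<noteq> v \<and> u \<noteq> w \<and> v \<noteq> w \<and>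
     i \<le> t \<and> 1 \<le> j \<and> j \<le> Suc t \<and>
     p = map (sdv v u) [i..<Suc t] @ map (sdv u w) [0..<Suc j])"

text \<open>The bounds on \<open>2 * i\<close> and \<open>2 * j\<close> say that the outer pieces
  cover at most half an edge; these are drawn as legs. The case \<open>w = z\<close> of a triangle
  is included.\<close>

definition spans_three :: "'a sd_vertex list \<Rightarrow> bool" where
  "spans_three p \<longleftrightarrow> (\<exists>w u v z i j. u \<in> V \<and> v \<in> V \<and> w \<in> V \<and> z \<in> V \<and>
     u \<noteq> v \<and> u \<noteq> w \<and> v \<noteq> z \<and> v \<noteq> w \<and> u \<noteq> z \<and>
     i \<le> t \<and> 1 \<le> j \<and> Suc t \<le> 2 * i \<and> 2 * j \<le> Suc t \<and>
     p = map (sdv w u) [i..<Suc t] @ map (sdv u v) [0..<Suc t] @ map (sdv v z) [0..<Suc j])"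

text \<open>Otherwise it is shorter to leave \<open>wu\<close> at \<open>w\<close>, or to enter \<open>vz\<close> at \<open>z\<close>.\<close>

lemma spans_threeI:
  assumes V: "u \<in> V" "v \<in> V" "w \<in> V" "z \<in> V"
    and ne: "u \<noteq> v" "u \<noteq> w" "v \<noteq> z" "v \<noteq> w" "u \<noteq> z" and ij: "i \<le> t" "1 \<le> j" "j \<le> Suc t"
    and p: "p = map (sdv w u) [i..<Suc t] @ map (sdv u v) [0..<Suc t] @ map (sdv v z) [0..<Suc j]"
    and sp: "shortest_path G p"
  shows "spans_three p"
proof -
  let ?e = "map (sdv v z) [0..<Suc j]"
  have hd_p: "hd p = sdv w u i"
    unfolding p using ne ij by (intro hd_run_append hd_run) auto
  have last_p: "last p = sdv v z j" unfolding p by (simp add: last_map_upt)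
  have len: "length p = (Suc t - i) + Suc t + Suc j" unfolding p by simp
  have e: "vwalk ?e (with_proj G)" "hd ?e = Branch v"
    using V ne ij vwalk_run[of v z 0 j] hd_run[of v z j "[]"] by auto
  have "Suc t \<le> 2 * i"
  proof -
    let ?m = "map (sdv w v) [0..<Suc t] @ ?e"
    \<comment> \<open>The detour returns to \<open>w\<close> and takes the edge \<open>wv\<close>.
      Position \<open>Suc t - i\<close> counted from \<open>u\<close> is the starting vertex of
      \<open>p\<close>, and the detour replaces \<open>Suc t - i\<close> steps by
      \<open>i\<close>.\<close>
    let ?q = "map (sdv u w) [Suc t - i..<Suc t] @ ?m"
    have "vwalk ?m (with_proj G)"
      by (rule vwalk_run_append[OF _ _ _ _ e]) (use V ne in auto)
    moreover have "hd ?m = Branch w"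
      by (rule hd_run) (use ne in auto)
    ultimately have m: "vwalk ?m (with_proj G)" "hd ?m = Branch w" by blast+
    have "vwalk ?q (with_proj G)" by (rule vwalk_run_append[OF _ _ _ _ m]) (use V ne in auto)
    moreover have "hd ?q = hd p"
      using hd_run_append[of u w "Suc t - i" ?m] m ne ij hd_p sdv_swap[of w u i] by simp
    moreover have "last ?q = last p" unfolding last_p by (simp add: last_map_upt)
    ultimately have "length p \<le> length ?q" by (rule shortest_path_le_vwalk[OF sp])
    then show ?thesis unfolding len using ij by simp
  qed
  moreover have "2 * j \<le> Suc t"
  proof -
    \<comment> \<open>The second detour goes from \<open>u\<close> to \<open>z\<close> and reaches
      the last vertex of \<open>p\<close> from there, in \<open>Suc t - j\<close> steps instead of
      \<open>j\<close>.\<close>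
    let ?l = "map (sdv z v) [0..<Suc (Suc t - j)]"
    let ?m = "map (sdv u z) [0..<Suc t] @ ?l"
    let ?q = "map (sdv w u) [i..<Suc t] @ ?m"
    have l: "vwalk ?l (with_proj G)" "hd ?l = Branch z"
      using V ne ij vwalk_run[of z v 0 "Suc t - j"] hd_run[of z v "Suc t - j" "[]"] by auto
    have "vwalk ?m (with_proj G)"
      by (rule vwalk_run_append[OF _ _ _ _ l]) (use V ne in auto)
    moreover have "hd ?m = Branch u"
      by (rule hd_run) (use ne in auto)
    ultimately have m: "vwalk ?m (with_proj G)" "hd ?m = Branch u" by blast+
    have "vwalk ?q (with_proj G)" by (rule vwalk_run_append[OF _ _ _ _ m]) (use V ne ij in auto)
    moreover have "hd ?q = hd p"
      using hd_run_append[of w u i ?m] m ne ij hd_p by simp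
    moreover have "last ?q = last p" unfolding last_p using sdv_swap[of v z j] ne ij by (simp add: last_map_upt)
    ultimately have "length p \<le> length ?q" by (rule shortest_path_le_vwalk[OF sp])
    then show ?thesis unfolding len using ij by simp
  qed
  ultimately show ?thesis unfolding spans_three_def using V ne ij p
    by - (rule exI[of _ w], rule exI[of _ u], rule exI[of _ v], rule exI[of _ z], rule exI[of _ i], rule exI[of _ j], simp)
qed

lemma Cons_run:
  assumes "0 < i" "i \<le> j"
  shows "sdv u v (i - 1) # map (sdv u v) [i..<j] @ p = map (sdv u v) [i - 1..<j] @ p"
  using assms upt_conv_Cons[of "i - 1" j] by simp

text \<open>A subdivision vertex has only two neighbours on its edge. One is already on the path, so
  a prepended vertex must be the other.\<close>

lemma predecessor_of_run:
  assumes p: "p = map (sdv u v) [i..<j] @ q" and uv: "u \<noteq> v" and i: "0 < i" "i \<le> t" "i < j"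
    and next_in: "sdv u v (Suc i) \<in> set p"
    and sp: "shortest_path G (x # p)"
  shows "x = sdv u v (i - 1)"
proof -
  have "hd p = sdv u v i" unfolding p using i by (simp add: upt_conv_Cons)
  moreover have "p \<noteq> []" using p i by auto
  ultimately have "(x, sdv u v i) \<in> parcs G" "x \<notin> set p"
    using sp by (auto simp: shortest_path_def vpath_def elim: vwalk_consE)
  then show ?thesis using arc_to_inner[OF _ uv i(1,2)] next_in by metis
qed

lemma predecessor_of_branch:
  assumes "hd p = Branch u" "p \<noteq> []" "sdv u v 1 \<in> set p" "u \<noteq> v" "shortest_path G (x # p)"
  obtains w where "w \<in> V" "w \<noteq> u" "w \<noteq> v" "x = sdv w u t"
proof -
  have "(x, Branch u) \<in> parcs G" "x \<notin> set p"
    using assms by (auto simp: shortest_path_def vpath_def elim: vwalk_consE)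
  moreover have "sdv v u t = sdv u v 1" using sdv_swap[of u v 1] assms by simp
  ultimately show ?thesis using arc_to_branch that assms by metis
qed

text \<open>Vertices are prepended one at a time: a path starting inside an edge continues along
  that edge, and one starting at a branch vertex opens a new edge. The minimality of the longer path
  enters through \<open>spans_threeI\<close>.\<close>

lemma shortest_path_spans:
  assumes "shortest_path G p" "length p \<ge> 2"
  shows "spans_one p \<or> spans_two p \<or> spans_three p"
  using assms
proof (induction p)
  case (Cons x p)
  then have ne: "p \<noteq> []" by auto
  have sp: "shortest_path G p" using Cons ne by (blast intro: shortest_path_tail)
  show ?case
  proof (cases "length p \<ge> 2")
    case False
    then obtain y where "p = [y]" using ne by (cases p; cases "tl p") auto
    then have "(x, y) \<in> parcs G"
      using Cons.prems by (auto simp: shortest_path_def vpath_def vwalk_def)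
    then obtain u v k where "u \<in> V" "v \<in> V" "u \<noteq> v" "k \<le> t" "x = sdv u v k" "y = sdv u v (Suc k)"
      unfolding arcs_G by blast
    moreover then have "x # p = map (sdv u v) [k..<Suc (Suc k)]"
      using \<open>p = [y]\<close> by (simp add: upt_conv_Cons)
    ultimately have "spans_one (x # p)" unfolding spans_one_def
      by - (rule exI[of _ u], rule exI[of _ v], rule exI[of _ k], rule exI[of _ "Suc k"], simp)
    then show ?thesis ..
  next
    case True
    then consider "spans_one p" | "spans_two p" | "spans_three p" using Cons.IH sp by blast
    then show ?thesis
    proof cases
      case 1
      then obtain u v i j where *: "u \<in> V" "v \<in> V" "u \<noteq> v" "i < j" "j \<le> Suc t"
        and p: "p = map (sdv u v) [i..<Suc j]" unfolding spans_one_def by blast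
      have nxt: "sdv u v (Suc i) \<in> set p" unfolding p set_map using * by (intro imageI) auto
      show ?thesis
      proof (cases "i = 0")
        case False
        then have "x = sdv u v (i - 1)"
          using * p nxt Cons.prems(1) by (intro predecessor_of_run[of p u v i "Suc j" "[]" x]) auto
        then have "x # p = map (sdv u v) [i - 1..<Suc j]"
          using Cons_run[of i "Suc j" u v "[]"] p False * by simp
        moreover have "i - 1 < j" using * by simp
        ultimately have "spans_one (x # p)" unfolding spans_one_def using *
          by - (rule exI[of _ u], rule exI[of _ v], rule exI[of _ "i - 1"], rule exI[of _ j], simp)
        then show ?thesis ..
      next
        case True
        have "hd p = Branch u" unfolding p using hd_run[of u v j "[]"] * True by simp
        then obtain w where w: "w \<in> V" "w \<noteq> u" "w \<noteq> v" "x = sdv w u t"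
          using predecessor_of_branch[of p u v x] ne nxt True * Cons.prems(1) by auto
        then have "x # p = map (sdv w u) [t..<Suc t] @ map (sdv u v) [0..<Suc j]"
          using p True by (simp add: upt_singleton)
        moreover have "t \<le> t" "1 \<le> j" using * by auto
        ultimately have "spans_two (x # p)" unfolding spans_two_def using * w
          by - (rule exI[of _ u], rule exI[of _ w], rule exI[of _ v], rule exI[of _ t], rule exI[of _ j], simp)
        then show ?thesis by blast
      qed
    next
      case 2
      then obtain u v w i j where *: "u \<in> V" "v \<in> V" "w \<in> V" "u \<noteq> v" "u \<noteq> w" "v \<noteq> w"
        "i \<le> t" "1 \<le> j" "j \<le> Suc t"
        and p: "p = map (sdv v u) [i..<Suc t] @ map (sdv u w) [0..<Suc j]"
        unfolding spans_two_def by blast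
      have nxt: "sdv v u (Suc i) \<in> set p"
      proof (cases "i = t")
        case True
        \<comment> \<open>For \<open>i = t\<close> the next vertex is \<open>Branch u\<close>, which
          belongs to the second run.\<close>
        then have "sdv v u (Suc i) = sdv u w 0" using * sdv_0 sdv_end by metis
        then show ?thesis unfolding p set_append set_map by auto
      next
        case False
        then show ?thesis unfolding p set_append set_map using * by (intro UnI1 imageI) auto
      qed
      show ?thesis
      proof (cases "i = 0")
        case False
        then have "x = sdv v u (i - 1)"
          using * p nxt Cons.prems(1) by (intro predecessor_of_run[of p v u i "Suc t" _ x]) auto
        then have "x # p = map (sdv v u) [i - 1..<Suc t] @ map (sdv u w) [0..<Suc j]"
          using Cons_run[of i "Suc t" v u] p False * by simp
        moreover have "i - 1 \<le> t" using * by simp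
        ultimately have "spans_two (x # p)" unfolding spans_two_def using *
          by - (rule exI[of _ u], rule exI[of _ v], rule exI[of _ w], rule exI[of _ "i - 1"], rule exI[of _ j], simp)
        then show ?thesis by blast
      next
        case True
        have "hd p = Branch v" unfolding p using hd_run[of v u t] * True by simp
        then obtain z where z: "z \<in> V" "z \<noteq> v" "z \<noteq> u" "x = sdv z v t"
          using predecessor_of_branch[of p v u x] ne nxt True * Cons.prems(1) by auto
        then have "x # p = map (sdv z v) [t..<Suc t] @ map (sdv v u) [0..<Suc t] @ map (sdv u w) [0..<Suc j]"
          using p True by (simp add: upt_singleton)
        then have "spans_three (x # p)"
          using * z Cons.prems(1) by (intro spans_threeI[of v u z w t j]) auto
        then show ?thesis by blast
      qed
    next
      case 3
      then obtain w u v z i j where *: "u \<in> V" "v \<in> V" "w \<in> V" "z \<in> V"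
        "u \<noteq> v" "u \<noteq> w" "v \<noteq> z" "v \<noteq> w" "u \<noteq> z" "i \<le> t" "1 \<le> j" "Suc t \<le> 2 * i" "2 * j \<le> Suc t"
        and p: "p = map (sdv w u) [i..<Suc t] @ map (sdv u v) [0..<Suc t] @ map (sdv v z) [0..<Suc j]"
        unfolding spans_three_def by blast
      have nxt: "sdv w u (Suc i) \<in> set p"
      proof (cases "i = t")
        case True
        then have "sdv w u (Suc i) = sdv u v 0" using * sdv_0 sdv_end by metis
        then show ?thesis unfolding p set_append set_map by auto
      next
        case False
        then show ?thesis unfolding p set_append set_map using * by (intro UnI1 imageI) auto
      qed
      \<comment> \<open>The bound \<open>Suc t \<le> 2 * i\<close> excludes \<open>i = 0\<close>, so
        the path starts at a subdivision vertex and no fourth edge can be opened.\<close>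
      have "x = sdv w u (i - 1)"
        using * p nxt Cons.prems(1) by (intro predecessor_of_run[of p w u i "Suc t" _ x]) auto
      then have "x # p = map (sdv w u) [i - 1..<Suc t] @ map (sdv u v) [0..<Suc t] @ map (sdv v z) [0..<Suc j]"
        using Cons_run[of i "Suc t" w u] p * by simp
      then have "spans_three (x # p)"
        using * Cons.prems(1) by (intro spans_threeI[of u v w z "i - 1" j]) auto
      then show ?thesis by blast
    qed
  qed
qed simp

end

section \<open>Straight-line drawings\<close>

text \<open>Curves are indexed by unordered pairs, so one of the two directions has to be chosen
  arbitrarily.\<close>

definition straight :: "('b \<Rightarrow> real \<times> real) \<Rightarrow> 'b set \<Rightarrow> real \<Rightarrow> real \<times> real" where
  "straight pos e = (SOME g. \<exists>x y. e = {x, y} \<and> g = linepath (pos x) (pos y))"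

lemma straight_cases:
  "straight pos {x, y} = linepath (pos x) (pos y) \<or> straight pos {x, y} = linepath (pos y) (pos x)"
proof -
  have "\<exists>g x' y'. {x, y} = {x', y'} \<and> g = linepath (pos x') (pos y')" by blast
  then have "\<exists>x' y'. {x, y} = {x', y'} \<and> straight pos {x, y} = linepath (pos x') (pos y')"
    unfolding straight_def by (rule someI_ex)
  then show ?thesis by (auto simp: doubleton_eq_iff)
qed

text \<open>\<open>edge_curve\<close> undoes the arbitrary choice of direction; if the two positions
  coincide, both directions are the same constant path.\<close>

lemma edge_curve_straight: "edge_curve pos (straight pos) x y = linepath (pos x) (pos y)"
  using straight_cases[of pos x y] by (auto simp: edge_curve_def reversepath_linepath)

lemma path_curve_Cons:
  "p \<noteq> [] \<Longrightarrow> path_curve pos crv (x # y # p) = edge_curve pos crv x y +++ path_curve pos crv (y # p)"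
  by (cases p) auto

lemma pathstart_path_curve:
  "length p \<ge> 2 \<Longrightarrow> pathstart (path_curve pos (straight pos) p) = pos (hd p)"
  by (induction pos "straight pos" p rule: path_curve.induct) (auto simp: edge_curve_straight)

lemma pathfinish_path_curve:
  "length p \<ge> 2 \<Longrightarrow> pathfinish (path_curve pos (straight pos) p) = pos (last p)"
  by (induction pos "straight pos" p rule: path_curve.induct) (auto simp: edge_curve_straight)

text \<open>Joins are nested to the right, hence the induction on the first part. Its first edge can
  meet the second part only in \<open>pos y\<close>, which is already on the remaining first part,
  so the only possible common point is still \<open>pos x'\<close>.\<close>

lemma path_curve_append:
  fixes pos :: "'b \<Rightarrow> real \<times> real"
  defines "pc \<equiv> path_curve pos (straight pos)"
  assumes "xs \<noteq> []" "ys \<noteq> []" and "arc (pc (xs @ [y]))" "arc (pc (y # ys))"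
    and "path_image (pc (xs @ [y])) \<inter> path_image (pc (y # ys)) \<subseteq> {pos y}"
  shows "arc (pc (xs @ y # ys)) \<and>
    path_image (pc (xs @ y # ys)) = path_image (pc (xs @ [y])) \<union> path_image (pc (y # ys))"
  using assms(2,4,6)
proof (induction xs)
  case (Cons x xs)
  have start: "pathstart (pc (y # ys)) = pos y"
    using \<open>ys \<noteq> []\<close> unfolding pc_def by (cases ys) (simp_all add: pathstart_path_curve)
  show ?case
  proof (cases xs)
    case Nil
    have "pc (x # y # ys) = pc [x, y] +++ pc (y # ys)"
      using \<open>ys \<noteq> []\<close> unfolding pc_def by (simp add: path_curve_Cons)
    moreover have "pathfinish (pc [x, y]) = pos y"
      unfolding pc_def by (simp add: edge_curve_straight)
    ultimately show ?thesis
      using Cons.prems \<open>arc (pc (y # ys))\<close> start Nil by (auto simp: arc_join path_image_join)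
  next
    case (Cons x' xs')
    let ?e = "linepath (pos x) (pos x')"
    have split: "pc (x # xs @ [y]) = ?e +++ pc (xs @ [y])" "pc (x # xs @ y # ys) = ?e +++ pc (xs @ y # ys)"
      unfolding pc_def Cons by (simp_all add: path_curve_Cons edge_curve_straight)
    have starts: "pathfinish ?e = pathstart (pc (xs @ [y]))" "pathfinish ?e = pathstart (pc (xs @ y # ys))"
      unfolding pc_def Cons by (simp_all add: pathstart_path_curve)
    have 1: "arc ?e" "arc (pc (xs @ [y]))" "path_image ?e \<inter> path_image (pc (xs @ [y])) \<subseteq> {pos x'}"
      using Cons.prems(2) starts(1) unfolding append_Cons split by (simp_all add: arc_join_eq)
    have im: "path_image (pc (x # xs @ [y])) = path_image ?e \<union> path_image (pc (xs @ [y]))"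
      unfolding split using starts by (simp add: path_image_join)
    have IH: "arc (pc (xs @ y # ys))"
      "path_image (pc (xs @ y # ys)) = path_image (pc (xs @ [y])) \<union> path_image (pc (y # ys))"
      using Cons.IH Cons.prems(3) 1(2) im Cons by auto
    have "path_image ?e \<inter> path_image (pc (y # ys)) \<subseteq> {pos y}"
      using Cons.prems(3) im by auto
    moreover have "pos y \<in> path_image (pc (xs @ [y]))"
      using pathfinish_in_path_image[of "pc (xs @ [y])"] pathfinish_path_curve[of "xs @ [y]" pos]
      unfolding pc_def Cons by simp
    ultimately have "path_image ?e \<inter> path_image (pc (xs @ y # ys)) \<subseteq> {pos x'}"
      unfolding IH(2) using 1(3) by blast
    then have "arc (?e +++ pc (xs @ y # ys))"
      using starts(2) 1(1) IH(1) by (intro arc_join) auto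
    then show ?thesis
      using starts(2) im unfolding append_Cons split(2) by (simp add: path_image_join IH(2) Un_assoc)
  qed
qed simp

section \<open>The drawing of the subdivided complete graph\<close>

locale subdivision_drawing = parabola_chords V r N + complete_subdivision V K t
  for V :: "'a::linorder set" and r N K t +
  assumes even_t: "even t"
begin

text \<open>The position along its chord of the \<open>k\<close>-th vertex of a subdivided edge. As \<open>t\<close> is even, every
  subdivision vertex has a nearer end, and it is placed within \<open>\<delta>\<close> of that end.\<close>

definition \<sigma> :: "nat \<Rightarrow> real" where
  "\<sigma> k = (if 2 * k \<le> t then \<delta> * real k / real (Suc t) else 1 - \<delta> * (real (Suc t) - real k) / real (Suc t))"

lemma \<sigma>_0 [simp]: "\<sigma> 0 = 0" and \<sigma>_end [simp]: "\<sigma> (Suc t) = 1"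
  by (auto simp: \<sigma>_def)

text \<open>As \<open>Suc t\<close> is odd, no vertex is in the middle, and reversing the edge
  exchanges the two branches of \<open>\<sigma>\<close>.\<close>

lemma \<sigma>_swap:
  assumes "k \<le> Suc t"
  shows "\<sigma> (Suc t - k) = 1 - \<sigma> k"
proof -
  have "2 * (Suc t - k) \<le> t \<longleftrightarrow> \<not> 2 * k \<le> t"
    using even_t assms by (auto elim!: evenE)
  then show ?thesis using assms by (simp add: \<sigma>_def of_nat_diff)
qed

lemma \<sigma>_le_\<delta>:
  assumes "2 * k \<le> Suc t"
  shows "\<sigma> k \<le> \<delta>"
proof -
  have k: "2 * k \<le> t" using assms even_t by (auto elim!: evenE)
  then have "\<delta> * real k \<le> \<delta> * real (Suc t)" using delta_pos by (intro mult_left_mono) auto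
  then show ?thesis using k by (simp add: \<sigma>_def field_simps)
qed

lemma \<sigma>_less:
  assumes "k < l" "l \<le> Suc t"
  shows "\<sigma> k < \<sigma> l"
proof -
  \<comment> \<open>On either half \<open>\<sigma>\<close> is affine; across the middle it jumps
    from at most \<delta> to at least \<open>1 - \<delta>\<close>.\<close>
  consider "2 * l \<le> t" | "2 * k \<le> t" "\<not> 2 * l \<le> t" | "\<not> 2 * k \<le> t" by linarith
  then show ?thesis
  proof cases
    case 1
    then show ?thesis using assms delta_pos by (simp add: \<sigma>_def divide_strict_right_mono)
  next
    case 2
    then have "2 * (Suc t - l) \<le> Suc t" by simp
    then have "1 - \<sigma> l \<le> \<delta>" using \<sigma>_le_\<delta> \<sigma>_swap[OF assms(2)] by metis
    moreover have "\<sigma> k \<le> \<delta>" using 2 by (intro \<sigma>_le_\<delta>) simp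
    ultimately show ?thesis using delta_le by linarith
  next
    case 3
    then show ?thesis using assms delta_pos by (simp add: \<sigma>_def divide_strict_right_mono)
  qed
qed

lemma \<sigma>_le: "k \<le> l \<Longrightarrow> l \<le> Suc t \<Longrightarrow> \<sigma> k \<le> \<sigma> l"
  using \<sigma>_less[of k l] by (cases "k = l") auto

lemma \<sigma>_bounds: "k \<le> Suc t \<Longrightarrow> 0 \<le> \<sigma> k" "k \<le> Suc t \<Longrightarrow> \<sigma> k \<le> 1"
  using \<sigma>_le[of 0 k] \<sigma>_le[of k "Suc t"] by simp_all

lemma \<sigma>_between:
  assumes "\<sigma> k \<le> \<sigma> m" "\<sigma> m \<le> \<sigma> l" "k \<le> Suc t" "l \<le> Suc t" "m \<le> Suc t"
  shows "k \<le> m" "m \<le> l"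
  using assms \<sigma>_less[of m k] \<sigma>_less[of l m] by (metis leD leI)+

fun pos :: "'a sd_vertex \<Rightarrow> real \<times> real" where
  "pos (Branch u) = corner u"
| "pos (Inner u v k) = chord u v (\<sigma> k)"

abbreviation pc :: "'a sd_vertex list \<Rightarrow> real \<Rightarrow> real \<times> real" where
  "pc \<equiv> path_curve pos (straight pos)"

lemma pos_sdv:
  assumes "u \<noteq> v" "k \<le> Suc t"
  shows "pos (sdv u v k) = chord u v (\<sigma> k)"
  using assms
proof (cases rule: sdv_cases)
  case 3
  then show ?thesis
    using chord_swap[of v u "\<sigma> k"] \<sigma>_swap[of k] by auto
qed auto

lemma pos_on_chord_aux:
  assumes V: "a \<in> V" "b \<in> V" "a \<noteq> b" "v \<in> V" "a \<noteq> v" and l: "l \<le> Suc t"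
    and eq: "pos (sdv a b l) = chord a v s"
  shows "\<exists>m\<le>Suc t. sdv a b l = sdv a v m \<and> \<sigma> m = s"
proof (cases "b = v")
  case True
  then show ?thesis using eq chord_inj[of a v "\<sigma> l" s] V l by (auto simp: pos_sdv)
next
  case False
  have e: "chord a b (\<sigma> l) = chord a v s" using eq V l by (simp add: pos_sdv)
  have "\<sigma> l = 0" "s = 0"
    using chords_adjacent[OF V(1,2,4,3,5) False e] chords_adjacent[OF V(1,4,2,5,3) _ e[symmetric]] False by auto
  then have "l = 0" using \<sigma>_less[of 0 l] l by (cases l) auto
  then show ?thesis using V \<open>s = 0\<close> by (intro exI[of _ 0]) (simp add: sdv_0)
qed

text \<open>Counted from its nearer end, the vertex lies on a leg, which meets the chord
  \<open>uv\<close> only if it starts at \<open>u\<close> or \<open>v\<close>. This gives both the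
  injectivity of \<open>pos\<close> and that edges avoid other vertices.\<close>

lemma pos_on_chord:
  assumes V: "a \<in> V" "b \<in> V" "a \<noteq> b" "u \<in> V" "v \<in> V" "u \<noteq> v" and l: "l \<le> Suc t"
    and eq: "pos (sdv a b l) = chord u v s"
  shows "\<exists>m\<le>Suc t. sdv a b l = sdv u v m \<and> \<sigma> m = s"
proof -
  have half: "\<exists>m\<le>Suc t. sdv a b l = sdv u v m \<and> \<sigma> m = s"
    if ab: "a \<in> V" "b \<in> V" "a \<noteq> b" and l: "2 * l \<le> Suc t" and eq: "pos (sdv a b l) = chord u v s" for a b l
  proof -
    have l': "l \<le> Suc t" using l by simp
    have "a = u \<or> a = v"
      using leg_meets_chord[of a b u v "\<sigma> l" s] ab V l eq \<sigma>_bounds[OF l'] \<sigma>_le_\<delta>[OF l] l'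
      by (simp add: pos_sdv)
    then show ?thesis
    proof
      assume "a = u"
      then show ?thesis using pos_on_chord_aux[of a b v l s] ab V l' eq by simp
    next
      assume "a = v"
      moreover have "pos (sdv a b l) = chord v u (1 - s)" using eq by (simp add: chord_swap)
      ultimately obtain m where m: "m \<le> Suc t" "sdv a b l = sdv v u m" "\<sigma> m = 1 - s"
        using pos_on_chord_aux[of a b u l "1 - s"] ab V l' by auto
      then have "sdv a b l = sdv u v (Suc t - m)" "\<sigma> (Suc t - m) = s"
        using sdv_swap[of v u m] \<sigma>_swap[of m] V by auto
      then show ?thesis by (intro exI[of _ "Suc t - m"]) simp
    qed
  qed
  show ?thesis
  proof (cases "2 * l \<le> Suc t")
    case True
    then show ?thesis using half[of a b l] V eq by simp
  next
    case False
    then show ?thesis using half[of b a "Suc t - l"] V eq l by (simp add: sdv_swap)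
  qed
qed

lemma is_drawing_pos: "is_drawing G pos (straight pos)"
  unfolding is_drawing_def
proof (intro conjI ballI)
  show "inj_on pos (pverts G)"
  proof (rule inj_onI)
    fix x y assume xy: "x \<in> pverts G" "y \<in> pverts G" "pos x = pos y"
    from xy(1) show "x = y"
    proof (cases rule: verts_cases)
      case (1 a b l)
      note x = 1
      from xy(2) show ?thesis
      proof (cases rule: verts_cases)
        case (1 u v k)
        then obtain m where m: "m \<le> Suc t" "x = sdv u v m" "\<sigma> m = \<sigma> k"
          using pos_on_chord[of a b u v l "\<sigma> k"] x xy(3) by (auto simp: pos_sdv)
        then show ?thesis using \<sigma>_less[of m k] \<sigma>_less[of k m] 1 by (cases m k rule: linorder_cases) auto
      next
        case (2 u)
        then show ?thesis using x by auto
      qed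
    next
      case (2 a)
      from xy(2) show ?thesis by (cases rule: verts_cases) (use 2 in auto)
    qed
  qed
next
  fix e assume "e \<in> parcs G"
  then obtain u v k where uv: "u \<in> V" "v \<in> V" "u \<noteq> v" and k: "k \<le> t" and e: "e = (sdv u v k, sdv u v (Suc k))"
    using arcs_G by (cases e) blast
  define x y where "x = sdv u v k" and "y = sdv u v (Suc k)"
  have xy: "pos x = chord u v (\<sigma> k)" "pos y = chord u v (\<sigma> (Suc k))"
    using uv k by (simp_all add: x_def y_def pos_sdv)
  have s: "\<sigma> k < \<sigma> (Suc k)" using k by (intro \<sigma>_less) auto
  then have ne: "pos x \<noteq> pos y" using chord_inj[OF uv] xy by (metis less_irrefl)
  have im: "path_image (straight pos {x, y}) = seg u v (\<sigma> k) (\<sigma> (Suc k))"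
    using straight_cases[of pos x y] s
    by (auto simp: xy[symmetric] seg_eq_closed_segment closed_segment_commute)
  have "pos w \<notin> path_image (straight pos {x, y})" if w: "w \<in> pverts G - {x, y}" for w
  proof
    assume "pos w \<in> path_image (straight pos {x, y})"
    then obtain c where c: "pos w = chord u v c" "\<sigma> k \<le> c" "c \<le> \<sigma> (Suc k)"
      unfolding im seg_def by auto
    \<comment> \<open>There is an edge, so \<open>V\<close> has two elements and every vertex lies
      on some edge.\<close>
    obtain a b l where "a \<in> V" "b \<in> V" "a \<noteq> b" "l \<le> Suc t" "w = sdv a b l"
      using w uv by (auto elim: verts_cases)
    then obtain m where m: "m \<le> Suc t" "w = sdv u v m" "\<sigma> m = c"
      using pos_on_chord[of a b u v l c] c uv by auto
    then have "k \<le> m" "m \<le> Suc k" using \<sigma>_between[of k m "Suc k"] c k by auto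
    then have "m = k \<or> m = Suc k" by auto
    then show False using w m by (auto simp: x_def y_def)
  qed
  moreover have "arc (straight pos {x, y})"
    "{pathstart (straight pos {x, y}), pathfinish (straight pos {x, y})} = {pos x, pos y}"
    using straight_cases[of pos x y] ne by auto
  ultimately show "case e of (u, v) \<Rightarrow> arc (straight pos {u, v}) \<and>
      {pathstart (straight pos {u, v}), pathfinish (straight pos {u, v})} = {pos u, pos v} \<and>
      (\<forall>w\<in>pverts G - {u, v}. pos w \<notin> path_image (straight pos {u, v}))"
    unfolding e x_def[symmetric] y_def[symmetric] by simp
qed

section \<open>Curves of shortest paths\<close>

lemma run_curve:
  assumes uv: "u \<in> V" "v \<in> V" "u \<noteq> v" and "i < j" "j \<le> Suc t"
  shows "arc (pc (map (sdv u v) [i..<Suc j])) \<and>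
    path_image (pc (map (sdv u v) [i..<Suc j])) = seg u v (\<sigma> i) (\<sigma> j)"
  using \<open>i < j\<close>
proof (induction i rule: strict_inc_induct)
  case (base i)
  have eq: "map (sdv u v) [i..<Suc j] = [sdv u v i, sdv u v j]"
    using base by (simp add: upt_conv_Cons)
  have s: "\<sigma> i < \<sigma> j" using base assms by (intro \<sigma>_less) auto
  then have "chord u v (\<sigma> i) \<noteq> chord u v (\<sigma> j)" using chord_inj[OF uv] by (metis less_irrefl)
  then show ?case
    using s base assms unfolding eq by (simp add: edge_curve_straight pos_sdv seg_eq_closed_segment)
next
  case (step i)
  let ?p = "map (sdv u v) [Suc (Suc i)..<Suc j]"
  have eq: "map (sdv u v) [i..<Suc j] = sdv u v i # sdv u v (Suc i) # ?p"
    "map (sdv u v) [Suc i..<Suc j] = sdv u v (Suc i) # ?p"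
    using step by (simp_all add: upt_conv_Cons)
  have s: "\<sigma> i < \<sigma> (Suc i)" "\<sigma> (Suc i) \<le> \<sigma> j" using step assms by (auto intro!: \<sigma>_less \<sigma>_le)
  let ?e = "linepath (pos (sdv u v i)) (pos (sdv u v (Suc i)))"
  have p: "pos (sdv u v i) = chord u v (\<sigma> i)" "pos (sdv u v (Suc i)) = chord u v (\<sigma> (Suc i))"
    using step assms by (simp_all add: pos_sdv)
  have "?p \<noteq> []" using step by simp
  then have split: "pc (map (sdv u v) [i..<Suc j]) = ?e +++ pc (map (sdv u v) [Suc i..<Suc j])"
    unfolding eq by (simp add: path_curve_Cons edge_curve_straight)
  have st: "pathstart (pc (map (sdv u v) [Suc i..<Suc j])) = pos (sdv u v (Suc i))"
    using \<open>?p \<noteq> []\<close> unfolding eq by (subst pathstart_path_curve) (auto simp: Suc_le_eq)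
  have "chord u v (\<sigma> i) \<noteq> chord u v (\<sigma> (Suc i))" using chord_inj[OF uv] s by (metis less_irrefl)
  then have e: "arc ?e" by (simp add: p)
  have ime: "path_image ?e = seg u v (\<sigma> i) (\<sigma> (Suc i))"
    using s by (simp add: p seg_eq_closed_segment)
  have "path_image ?e \<inter> path_image (pc (map (sdv u v) [Suc i..<Suc j])) \<subseteq> {pos (sdv u v (Suc i))}"
  proof
    fix z assume "z \<in> path_image ?e \<inter> path_image (pc (map (sdv u v) [Suc i..<Suc j]))"
    then obtain c d where "z = chord u v c" "c \<le> \<sigma> (Suc i)" "z = chord u v d" "\<sigma> (Suc i) \<le> d"
      unfolding ime step.IH[THEN conjunct2] seg_def Int_iff image_iff Bex_def atLeastAtMost_iff by blast
    moreover then have "c = d" using chord_inj[OF uv] by metis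
    ultimately show "z \<in> {pos (sdv u v (Suc i))}" by (simp add: p)
  qed
  then have "arc (?e +++ pc (map (sdv u v) [Suc i..<Suc j]))"
    using e st step.IH by (intro arc_join) auto
  moreover have "path_image (?e +++ pc (map (sdv u v) [Suc i..<Suc j])) = seg u v (\<sigma> i) (\<sigma> j)"
    using st s step.IH seg_union[of "\<sigma> i" "\<sigma> (Suc i)" "\<sigma> j" u v] ime
    by (simp add: path_image_join del: path_image_linepath)
  ultimately show ?case unfolding split by blast
qed

text \<open>The image of the run is written from its end \<open>v\<close>, so that it starts at the
  shared corner as in \<open>two_segments\<close> and \<open>chord_with_legs\<close>.\<close>

lemma run_append_curve:
  assumes uv: "u \<in> V" "v \<in> V" "u \<noteq> v" "i \<le> t" and p: "p = Branch v # q" "q \<noteq> []" "arc (pc p)"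
    and inter: "seg v u 0 (1 - \<sigma> i) \<inter> path_image (pc p) \<subseteq> {corner v}"
  shows "arc (pc (map (sdv u v) [i..<Suc t] @ p)) \<and>
    path_image (pc (map (sdv u v) [i..<Suc t] @ p)) = seg v u 0 (1 - \<sigma> i) \<union> path_image (pc p)"
proof -
  have run: "map (sdv u v) [i..<Suc t] @ [Branch v] = map (sdv u v) [i..<Suc (Suc t)]"
    using uv sdv_end[OF uv(3)] by (simp add: upt_Suc_append)
  have c: "arc (pc (map (sdv u v) [i..<Suc t] @ [Branch v]))"
    "path_image (pc (map (sdv u v) [i..<Suc t] @ [Branch v])) = seg v u 0 (1 - \<sigma> i)"
    unfolding run using run_curve[OF uv(1-3), of i "Suc t"] uv(4) seg_swap[of v u 0 "1 - \<sigma> i"] by auto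
  have "map (sdv u v) [i..<Suc t] \<noteq> []" using uv by simp
  from path_curve_append[OF this p(2), of pos "Branch v"] c p inter show ?thesis by simp
qed

lemma spans_two_curve:
  assumes V: "u \<in> V" "v \<in> V" "w \<in> V" "u \<noteq> v" "u \<noteq> w" "v \<noteq> w" and ij: "i \<le> t" "1 \<le> j" "j \<le> Suc t"
  defines "p \<equiv> map (sdv v u) [i..<Suc t] @ map (sdv u w) [0..<Suc j]"
  shows "arc (pc p) \<and> path_image (pc p) = seg u v 0 (1 - \<sigma> i) \<union> seg u w 0 (\<sigma> j)"
proof -
  have q: "map (sdv u w) [0..<Suc j] = Branch u # map (sdv u w) [1..<Suc j]"
    using V by (simp add: upt_conv_Cons sdv_0)
  have r: "arc (pc (map (sdv u w) [0..<Suc j]))" "path_image (pc (map (sdv u w) [0..<Suc j])) = seg u w 0 (\<sigma> j)"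
    using run_curve[of u w 0 j] V ij by auto
  have "seg u v 0 (1 - \<sigma> i) \<inter> seg u w 0 (\<sigma> j) \<subseteq> {corner u}"
  proof
    fix z assume "z \<in> seg u v 0 (1 - \<sigma> i) \<inter> seg u w 0 (\<sigma> j)"
    then obtain c d where "z = chord u v c" "chord u v c = chord u w d"
      unfolding seg_def by auto
    then show "z \<in> {corner u}" using chords_adjacent[of u v w c d] V by simp
  qed
  then show ?thesis
    using run_append_curve[of v u i "map (sdv u w) [0..<Suc j]" "map (sdv u w) [1..<Suc j]"] V ij q r
    unfolding p_def by auto
qed

lemma shortest_path_curve:
  assumes "shortest_path G p" "length p \<ge> 2"
  shows "arc (pc p)"
    and "(\<exists>u v a b. path_image (pc p) = seg u v a b) \<or> two_segments (path_image (pc p))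
      \<or> chord_with_legs (path_image (pc p))" (is ?shape)
proof -
  consider "spans_one p" | "spans_two p" | "spans_three p"
    using shortest_path_spans[OF assms] by blast
  then have "arc (pc p) \<and> ?shape"
  proof cases
    case 1
    then obtain u v i j where *: "u \<in> V" "v \<in> V" "u \<noteq> v" "i < j" "j \<le> Suc t"
      and p: "p = map (sdv u v) [i..<Suc j]" unfolding spans_one_def by blast
    show ?thesis using run_curve[OF *] unfolding p by blast
  next
    case 2
    then obtain u v w i j where *: "u \<in> V" "v \<in> V" "w \<in> V" "u \<noteq> v" "u \<noteq> w" "v \<noteq> w"
      "i \<le> t" "1 \<le> j" "j \<le> Suc t"
      and p: "p = map (sdv v u) [i..<Suc t] @ map (sdv u w) [0..<Suc j]"
      unfolding spans_two_def by blast
    have c: "arc (pc p)" "path_image (pc p) = seg u v 0 (1 - \<sigma> i) \<union> seg u w 0 (\<sigma> j)"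
      using spans_two_curve[OF *] unfolding p by blast+
    have "two_segments (path_image (pc p))"
      unfolding two_segments_def
      by (rule exI[of _ u], rule exI[of _ v], rule exI[of _ w], rule exI[of _ "1 - \<sigma> i"], rule exI[of _ "\<sigma> j"])
         (use * c \<sigma>_bounds[of i] \<sigma>_bounds[of j] in simp)
    then show ?thesis using c by blast
  next
    case 3
    then obtain w u v z i j where *: "u \<in> V" "v \<in> V" "w \<in> V" "z \<in> V"
      "u \<noteq> v" "u \<noteq> w" "v \<noteq> z" "v \<noteq> w" "u \<noteq> z" "i \<le> t" "1 \<le> j" "Suc t \<le> 2 * i" "2 * j \<le> Suc t"
      and p: "p = map (sdv w u) [i..<Suc t] @ map (sdv u v) [0..<Suc t] @ map (sdv v z) [0..<Suc j]"
      unfolding spans_three_def by blast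
    let ?q = "map (sdv u v) [0..<Suc t] @ map (sdv v z) [0..<Suc j]"
    have q: "?q = Branch u # map (sdv u v) [1..<Suc t] @ map (sdv v z) [0..<Suc j]"
      using * by (simp add: upt_conv_Cons sdv_0)
    \<comment> \<open>The chord and the last leg form two segments at \<open>v\<close>, the first
      with \<open>i = 0\<close> and hence of full length.\<close>
    have r: "arc (pc ?q)" "path_image (pc ?q) = seg u v 0 1 \<union> seg v z 0 (\<sigma> j)"
      using spans_two_curve[of v u z 0 j] * seg_swap[of u v 0 1] by auto
    have legs: "0 \<le> \<sigma> j" "\<sigma> j \<le> \<delta>" "0 \<le> 1 - \<sigma> i" "1 - \<sigma> i \<le> \<delta>"
      using \<sigma>_bounds[of j] \<sigma>_bounds[of i] \<sigma>_le_\<delta>[of j] \<sigma>_le_\<delta>[of "Suc t - i"] \<sigma>_swap[of i] * by auto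
    have "seg u w 0 (1 - \<sigma> i) \<inter> seg u v 0 1 \<subseteq> {corner u}"
    proof
      fix y assume "y \<in> seg u w 0 (1 - \<sigma> i) \<inter> seg u v 0 1"
      then obtain c d where "y = chord u w c" "chord u w c = chord u v d"
        unfolding seg_def by auto
      then show "y \<in> {corner u}" using chords_adjacent[of u w v c d] * by simp
    qed
    \<comment> \<open>Legs at different corners are disjoint, so the whole curve stays
      injective.\<close>
    moreover have "seg u w 0 (1 - \<sigma> i) \<inter> seg v z 0 (\<sigma> j) = {}"
      using leg_inter_leg[of u w v z "1 - \<sigma> i" "\<sigma> j"] * legs by blast
    ultimately have "seg u w 0 (1 - \<sigma> i) \<inter> path_image (pc ?q) \<subseteq> {corner u}"
      unfolding r by blast
    then have c: "arc (pc p)" "path_image (pc p) = seg u w 0 (1 - \<sigma> i) \<union> path_image (pc ?q)"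
      using run_append_curve[OF _ _ _ _ q _ r(1), of w i] * unfolding p by auto
    have "chord_with_legs (path_image (pc p))"
      unfolding chord_with_legs_def
      by (rule exI[of _ u], rule exI[of _ v], rule exI[of _ w], rule exI[of _ z],
          rule exI[of _ "1 - \<sigma> i"], rule exI[of _ "\<sigma> j"])
         (use * c r legs in \<open>simp add: Un_assoc\<close>)
    then show ?thesis using c by blast
  qed
  then show "arc (pc p)" ?shape by blast+
qed

lemma shortest_paths_cross_at_most_4:
  assumes "shortest_path G p" "length p \<ge> 2" "shortest_path G q" "length q \<ge> 2"
  shows "cross_at_most 4 (pc p) (pc q)"
proof -
  have "covered_by_connected 4 (path_image (pc p) \<inter> path_image (pc q))"
    using shortest_path_curve(2)[OF assms(1,2)] shortest_path_curve(2)[OF assms(3,4)]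
    by (rule inter_covered)
  then obtain Cs where Cs: "length Cs \<le> 4" "path_image (pc p) \<inter> path_image (pc q) = \<Union>(set Cs)"
    "\<And>C. C \<in> set Cs \<Longrightarrow> Topological_Spaces.connected C"
    unfolding covered_by_connected_def by blast
  have "card (set Cs) \<le> 4" using card_length[of Cs] Cs(1) by simp
  then show ?thesis
    using shortest_path_curve(1)[OF assms(1,2)] shortest_path_curve(1)[OF assms(3,4)] Cs
    by (intro cross_at_most_of_connected_cover[of _ _ "set Cs"]) auto
qed

end

theorem theorem2:
  fixes n t :: nat and K :: "'a::linorder pair_pre_digraph"
  assumes "n \<ge> 1" and "even t" and "complete_digraph n (with_proj K)"
  shows "\<exists>pos crv. is_drawing (subdivide_all t K) pos crv \<and>
           (\<forall>P\<^sub>1 P\<^sub>2. shortest_path (subdivide_all t K) P\<^sub>1 \<and> shortest_path (subdivide_all t K) P\<^sub>2 \<and>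
              vwalk_length P\<^sub>1 \<ge> 1 \<and> vwalk_length P\<^sub>2 \<ge> 1 \<longrightarrow>
              cross_at_most 4 (path_curve pos crv P\<^sub>1) (path_curve pos crv P\<^sub>2))"
proof -
  have fin: "finite (pverts K)" and arcs: "parcs K = {(u, v). u \<in> pverts K \<and> v \<in> pverts K \<and> u \<noteq> v}"
    using assms(3) by (auto simp: complete_digraph_pair_def)
  \<comment> \<open>Numbering the vertices below \<open>N\<close> supplies the abscissas of the
    corners together with their bound.\<close>
  obtain r :: "'a \<Rightarrow> nat" and N where r: "r ` pverts K = {i. i < N}" "inj_on r (pverts K)"
    using finite_imp_inj_to_nat_seg[OF fin] by blast
  interpret subdivision_drawing "pverts K" r N K t
    using r arcs \<open>even t\<close> by unfold_locales (auto intro: less_imp_le)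
  show ?thesis
    by (rule exI[of _ pos], rule exI[of _ "straight pos"])
       (use is_drawing_pos shortest_paths_cross_at_most_4 in auto)
qed

end
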